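(* Let $1\le k<n$, let $\mathbf{F}$ be a field, let $\mathbf{K}$ be the splitting field over $\mathbf{F}$ of the polynomial $x^n+(-1)^k$ (this field also contains the $n$th roots of unity), and fix $\xi\in\mathbf{K}$ with $\xi^n+(-1)^k=0$. For any admissible multiset $J=\{\zeta_1,\dots,\zeta_k\}$ of $n$th roots of unity, there is a ring homomorphism $$\mathrm{ev}_J:\mathrm{QH}^*(\mathrm{Gr}(k,n);\mathbf{F})\to\mathbf{K}$$ sending $q$ to $1$ and, for $i=1,\dots,k$, sending $x_i$ to $$\mathrm{ev}_J(x_i)=\xi^i\sum\zeta_1^{i_1}\cdots\zeta_k^{i_k},$$ where the sum is over all $(i_1,\dots,i_k)\in\{0,1\}^k$ with $i_1+\dots+i_k=i$ (i.e. $\xi^i$ times the $i$th elementary symmetric polynomial evaluated at $\zeta_1,\dots,\zeta_k$).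
   Context: Admissible multisets. If $\mathrm{char}(\mathbf{F})=p>0$, write $n=p^dm$ with $p\nmid m$; a multiset $J=\{\zeta_1,\dots,\zeta_k\}$ of $n$th roots of unity is admissible if each root appears with multiplicity at most $p^d$. If $\mathrm{char}(\mathbf{F})=0$, an admissible multiset is a set of $k$ distinct $n$th roots of unity. Quantum cohomology. $\mathrm{Gr}(k,n)$ is the Grassmannian of complex $k$-planes in $\mathbf{C}^n$. $H^*(\mathrm{Gr}(k,n);\mathbf{Z})$ is the free graded $\mathbf{Z}$-module on Schubert classes $\sigma_D$, where $D$ runs over Young diagrams fitting in a rectangle with $k$ rows and $n-k$ columns. Complex degrees are used: $\deg\sigma_D$ is the number of boxes of $D$. Let $q$ be a formal variable of degree $n$. The module $H^*(\mathrm{Gr}(k,n);\mathbf{Z})\otimes\mathbf{Z}[q]$ carries the (small) quantum cup product $\ast$, a graded, commutative, associative $\mathbf{Z}[q]$-bilinear deformation of the cup product by three-point genus-zero Gromov–Witten invariants, with unit $1=\sigma_\emptyset$. For a field $\mathbf{F}$, $$\mathrm{QH}^*(\mathrm{Gr}(k,n);\mathbf{F}):=(H^*(\mathrm{Gr}(k,n);\mathbf{Z})\otimes\mathbf{Z}[q])\otimes_{\mathbf{Z}[q]}\mathbf{F}[q^{-1},q].$$ The product is determined by the quantum Pieri rule $x_j\ast\sigma_D=\sum_{D'}\sigma_{D'}+\sum_{D''}q\,\sigma_{D''}$, where $x_j$ ($1\le j\le k$) is the class of the diagram consisting of a single column of $j$ boxes. The first sum is over diagrams $D'$ (in the rectangle)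 obtained from $D$ by adding $j$ boxes, at most one in each row. The second sum occurs only if the top row of $D$ is full (has $n-k$ boxes), and is over all diagrams $D''$ obtained from $D$ by removing $n-j$ boxes consisting of the entire top row and at most one box in each of the other rows, and then shifting the result up by one row. *)

theory Defs
  imports
    "HOL-Algebra.Generated_Fields"
    "HOL-Algebra.Algebraic_Closure_Type"
    "HOL-Library.Poly_Mapping"
    "HOL-Library.Multiset"
begin

text \<open>
  A Young diagram in the rectangle with \<open>k\<close> rows and \<open>n - k\<close> columns is the list of its \<open>k\<close> row
  lengths, top row first, with zeros for empty rows.
\<close>

definition diagrams :: "nat \<Rightarrow> nat \<Rightarrow> nat list set" where
  "diagrams k n =
     {D. length D = k \<and> (\<forall>i<k. D ! i \<le> n - k) \<and> (\<forall>i j. i \<le> j \<longrightarrow> j < k \<longrightarrow> D ! j \<le> D ! i)}"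

definition empty_diagram :: "nat \<Rightarrow> nat list" where
  "empty_diagram k = replicate k 0"

definition column :: "nat \<Rightarrow> nat \<Rightarrow> nat list" where
  "column k j = replicate j 1 @ replicate (k - j) 0"

text \<open>
  Elements of the free module on the Schubert classes over a coefficient ring are represented by
  their coefficient functions, which vanish off \<open>diagrams k n\<close>.
\<close>

definition free_module :: "nat \<Rightarrow> nat \<Rightarrow> (nat list \<Rightarrow> 'a::zero) set" where
  "free_module k n = {a. \<forall>D. D \<notin> diagrams k n \<longrightarrow> a D = 0}"

definition schubert :: "nat list \<Rightarrow> (nat list \<Rightarrow> 'a::zero_neq_one)" where
  "schubert D = (\<lambda>E. if E = D then 1 else 0)"

definition scale :: "'a::times \<Rightarrow> (nat list \<Rightarrow> 'a) \<Rightarrow> (nat list \<Rightarrow> 'a)" where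
  "scale c a = (\<lambda>D. c * a D)"

text \<open>The class of \<open>D\<close> has degree \<open>sum_list D\<close> and \<open>q\<close> has degree \<open>n\<close>.\<close>

definition homogeneous :: "nat \<Rightarrow> nat \<Rightarrow> (nat list \<Rightarrow> int poly) \<Rightarrow> bool" where
  "homogeneous n d a \<longleftrightarrow> (\<forall>D i. Polynomial.coeff (a D) i \<noteq> 0 \<longrightarrow> sum_list D + n * i = d)"

definition pieri_classical :: "nat \<Rightarrow> nat \<Rightarrow> nat \<Rightarrow> nat list \<Rightarrow> nat list set" where
  "pieri_classical k n j D =
     {D' \<in> diagrams k n. sum_list D' = sum_list D + j \<and>
        (\<forall>i<k. D ! i \<le> D' ! i \<and> D' ! i \<le> D ! i + 1)}"

text \<open>
  The upward shift places row \<open>i + 1\<close> of \<open>D\<close>, with at most one box removed, in row \<open>i\<close> of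
  the new diagram, and leaves its last row empty.
\<close>

definition pieri_quantum :: "nat \<Rightarrow> nat \<Rightarrow> nat \<Rightarrow> nat list \<Rightarrow> nat list set" where
  "pieri_quantum k n j D =
     {D'' \<in> diagrams k n. D ! 0 = n - k \<and> sum_list D'' + (n - j) = sum_list D \<and>
        D'' ! (k - 1) = 0 \<and>
        (\<forall>i. i + 1 < k \<longrightarrow> D'' ! i \<le> D ! (i + 1) \<and> D ! (i + 1) \<le> D'' ! i + 1)}"

text \<open>
  The small quantum cup product on \<open>H\<^sup>*(Gr(k,n); \<int>) \<otimes> \<int>[q]\<close>. The Gromov-Witten invariants do not
  appear: the classes of the columns generate the ring over \<open>\<int>[q]\<close>, so the conditions below
  determine \<open>star\<close> on \<open>free_module k n\<close>.
\<close>

locale quantum_cup_product =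
  fixes k n :: nat
    and star :: "(nat list \<Rightarrow> int poly) \<Rightarrow> (nat list \<Rightarrow> int poly) \<Rightarrow> (nat list \<Rightarrow> int poly)"
      (infixl "\<star>" 70)
  assumes closed: "\<lbrakk>a \<in> free_module k n; b \<in> free_module k n\<rbrakk> \<Longrightarrow> a \<star> b \<in> free_module k n"
    and commute: "\<lbrakk>a \<in> free_module k n; b \<in> free_module k n\<rbrakk> \<Longrightarrow> a \<star> b = b \<star> a"
    and assoc: "\<lbrakk>a \<in> free_module k n; b \<in> free_module k n; c \<in> free_module k n\<rbrakk>
      \<Longrightarrow> (a \<star> b) \<star> c = a \<star> (b \<star> c)"
    and unit: "a \<in> free_module k n \<Longrightarrow> schubert (empty_diagram k) \<star> a = a"
    and add_left: "\<lbrakk>a \<in> free_module k n; b \<in> free_module k n; c \<in> free_module k n\<rbrakk>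
      \<Longrightarrow> (\<lambda>D. a D + b D) \<star> c = (\<lambda>D. (a \<star> c) D + (b \<star> c) D)"
    and scale_left: "\<lbrakk>a \<in> free_module k n; b \<in> free_module k n\<rbrakk>
      \<Longrightarrow> scale r a \<star> b = scale r (a \<star> b)"
    and graded: "\<lbrakk>a \<in> free_module k n; b \<in> free_module k n; homogeneous n d a; homogeneous n e b\<rbrakk>
      \<Longrightarrow> homogeneous n (d + e) (a \<star> b)"
    and pieri: "\<lbrakk>1 \<le> j; j \<le> k; D \<in> diagrams k n\<rbrakk>
      \<Longrightarrow> schubert (column k j) \<star> schubert D =
          (\<lambda>E. (\<Sum>D'\<in>pieri_classical k n j D. schubert D' E) +
                (\<Sum>D''\<in>pieri_quantum k n j D. scale [:0, 1:] (schubert D'') E))"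

text \<open>The Laurent polynomial ring \<open>F[q\<^sup>-\<^sup>1, q]\<close> is the monoid algebra \<open>int \<Rightarrow>\<^sub>0 'f\<close>.\<close>

definition laurent_q :: "int \<Rightarrow>\<^sub>0 'f::field" where
  "laurent_q = Poly_Mapping.single 1 1"

definition base_change :: "int poly \<Rightarrow> (int \<Rightarrow>\<^sub>0 'f::field)" where
  "base_change p = poly (map_poly of_int p) laurent_q"

text \<open>
  The extension of scalars of the free \<open>\<int>[q]\<close>-algebra along \<open>\<int>[q] \<rightarrow> F[q\<^sup>-\<^sup>1, q]\<close> is the
  free module on the same basis, with structure constants mapped by \<open>base_change\<close>.
\<close>

definition QH ::
  "nat \<Rightarrow> nat \<Rightarrow> ((nat list \<Rightarrow> int poly) \<Rightarrow> (nat list \<Rightarrow> int poly) \<Rightarrow> (nat list \<Rightarrow> int poly))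
     \<Rightarrow> (nat list \<Rightarrow> (int \<Rightarrow>\<^sub>0 'f::field)) ring" where
  "QH k n star =
     \<lparr> carrier = free_module k n,
       monoid.mult = (\<lambda>a b G. \<Sum>D\<in>diagrams k n. \<Sum>E\<in>diagrams k n.
         a D * b E * base_change (star (schubert D) (schubert E) G)),
       one = schubert (empty_diagram k),
       ring.zero = (\<lambda>_. 0),
       add = (\<lambda>a b D. a D + b D) \<rparr>"

definition QH_q :: "nat \<Rightarrow> (nat list \<Rightarrow> (int \<Rightarrow>\<^sub>0 'f::field))" where
  "QH_q k = scale laurent_q (schubert (empty_diagram k))"

text \<open>The extension \<open>K\<close> of \<open>F\<close> is given by its structure map \<open>\<iota>\<close>.\<close>

definition is_splitting_field :: "('f::field \<Rightarrow> 'K::field) \<Rightarrow> 'f poly \<Rightarrow> bool" where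
  "is_splitting_field \<iota> p \<longleftrightarrow>
     \<iota> \<in> ring_hom ring_of_type_algebra ring_of_type_algebra \<and> p \<noteq> 0 \<and>
     (\<exists>rs. map_poly \<iota> p = Polynomial.smult (\<iota> (lead_coeff p)) (\<Prod>r\<leftarrow>rs. [:- r, 1:]) \<and>
           generate_field ring_of_type_algebra (range \<iota> \<union> set rs) = UNIV)"

text \<open>
  The argument \<open>p\<close> is the characteristic of the ground field; for \<open>p > 0\<close> the bound
  \<open>p ^ multiplicity p n\<close> is the largest power of \<open>p\<close> dividing \<open>n\<close>.
\<close>

definition admissible :: "nat \<Rightarrow> nat \<Rightarrow> nat \<Rightarrow> 'K::field multiset \<Rightarrow> bool" where
  "admissible p k n J \<longleftrightarrow>
     size J = k \<and> (\<forall>\<zeta>\<in>#J. \<zeta> ^ n = 1) \<and>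
     (\<forall>\<zeta>. count J \<zeta> \<le> (if p = 0 then 1 else p ^ multiplicity p n))"

end

(*
  Write z_i = xi * zeta_i and f = prod (t - z_i). Admissibility of J says exactly that f divides
  t^n + (-1)^k, so t^n = (-1)^(k-1) in the k-dimensional algebra V = K[t]/f, also when J has
  repeated elements. Send sigma_D to the determinant of the vectors t^(D_r + k - r), r = 1..k, in V
  (for distinct z_i: the Schur polynomial at z). For the operator T of multiplication by t,
  comparing coefficients of x in det (1 + x T) shows that multiplication by e_j(z) adds 1 to j of
  the exponents in all ways. If the largest exponent becomes n, the relation for t^n turns it into
  0, and the sign (-1)^(k-1) is cancelled by that of the cyclic permutation of the rows: these
  terms are the quantum terms of the Pieri rule at q = 1. So the functional is compatible with
  multiplication by the x_j, and multiplicative because the x_j generate.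
*)

theory Submission
  imports Defs
begin

text \<open>The algebra V enters only through coordinates: in its Newton basis 1, t - z_0, (t -
  z_0)(t - z_1), ... the l-th coordinate of t^a is the divided difference
  \<open>divdiff z a l\<close>. This basis exists for repeated nodes as well, multiplication by t is
  bidiagonal in it with the z_l on the diagonal, and t^0, ..., t^(k-1) have a unitriangular
  coordinate matrix. So the value of the empty diagram is 1 without division by a Vandermonde
  determinant, which would vanish for repeated nodes. The product \<open>star\<close> is known only
  through axioms that make products with columns explicit. To pass to all products, each Schubert
  class is solved for in the Pieri rule of the diagram without its first column. The quantum terms
  have fewer boxes, but the other classical terms have equally many, so the number of boxes alone
  does not decrease; the number of empty rows breaks the tie. All this happens over the integers
  with q = 1; extending scalars afterwards only involves the values of the structure constants at q
  = 1.\<close>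

section \<open>Admissible multisets\<close>

text \<open>Grouping equal nodes writes the product as a product of powers with exponents at most N.
  The linear factors at distinct roots of P are coprime, so each distinct root may be used once in P
  and N times in \<open>P ^ N\<close>.\<close>

lemma prod_dvd_if_multiplicity_le:
  fixes z :: "'i \<Rightarrow> 'a::field"
  assumes I: "finite I" and N: "\<And>a. card {i \<in> I. z i = a} \<le> N"
    and root: "\<And>i. i \<in> I \<Longrightarrow> poly P (z i) = 0"
  shows "(\<Prod>i\<in>I. [:- z i, 1:]) dvd P ^ N"
proof -
  have "(\<Prod>i\<in>I. [:- z i, 1:]) = (\<Prod>a\<in>z ` I. \<Prod>i\<in>{i \<in> I. z i = a}. [:- z i, 1:])"
    by (rule prod.image_gen[OF I])
  also have "\<dots> = (\<Prod>a\<in>z ` I. [:- a, 1:] ^ card {i \<in> I. z i = a})"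
    by (intro prod.cong refl) simp
  also have "\<dots> dvd (\<Prod>a\<in>z ` I. [:- a, 1:] ^ N)"
    using N by (intro prod_dvd_prod le_imp_power_dvd)
  also have "\<dots> = (\<Prod>a\<in>z ` I. [:- a, 1:]) ^ N"
    by (rule prod_power_distrib[symmetric])
  also have "\<dots> dvd P ^ N"
  proof (rule dvd_power_same)
    have "finite S \<Longrightarrow> S \<subseteq> z ` I \<Longrightarrow> (\<Prod>a\<in>S. [:- a, 1:]) dvd P" for S
    proof (induction S rule: finite_induct)
      case (insert b S)
      then obtain Q where Q: "P = (\<Prod>a\<in>S. [:- a, 1:]) * Q" by (auto elim: dvdE)
      have "poly P b = 0" using insert root by auto
      moreover have "poly (\<Prod>a\<in>S. [:- a, 1:]) b \<noteq> 0"
        using insert by (auto simp: poly_prod)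
      ultimately have "[:- b, 1:] dvd Q"
        by (simp add: Q poly_eq_0_iff_dvd)
      thus ?case
        unfolding Q prod.insert[OF insert.hyps] mult.commute[of "[:- b, 1:]"]
        by (intro mult_dvd_mono dvd_refl)
    qed simp
    with I show "(\<Prod>a\<in>z ` I. [:- a, 1:]) dvd P" by simp
  qed
  finally show ?thesis .
qed

text \<open>With \<open>n = p ^ d * m\<close>, the polynomial \<open>t ^ n - \<xi> ^ n\<close> is the \<open>p ^ d\<close>-th power of
  \<open>t ^ m - \<xi> ^ m\<close>, which vanishes at all the nodes.\<close>

lemma admissible_prod_dvd:
  fixes \<xi> :: "'K::field" and \<zeta> :: "nat \<Rightarrow> 'K"
  assumes "1 \<le> k" "k < n" and \<xi>: "\<xi> ^ n + (- 1) ^ k = 0"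
    and adm: "admissible CHAR('K) k n (image_mset \<zeta> (mset_set {1..k}))"
  shows "(\<Prod>i<k. [:- (\<xi> * \<zeta> (Suc i)), 1:]) dvd Polynomial.monom 1 n - [:(- 1) ^ (k - 1):]"
proof -
  let ?p = "CHAR('K)"
  define N where "N = (if ?p = 0 then 1 else ?p ^ multiplicity ?p n)"
  have "n > 0" using assms by simp
  have prime: "Factorial_Ring.prime ?p" if "?p \<noteq> 0"
    using that prime_CHAR_semidom[where 'a = 'K] by simp
  obtain m where m: "n = m * N"
  proof (cases "?p = 0")
    case False
    thus ?thesis
      using that multiplicity_dvd[of ?p n] by (auto simp: N_def dvd_def mult.commute)
  qed (use that[of n] in \<open>simp add: N_def\<close>)
  \<comment> \<open>In characteristic 0 the exponent N is 1 and this is trivial; otherwise N is a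
    power of the characteristic.\<close>
  have frob: "(a + b) ^ N = a ^ N + b ^ N" for a b :: 'K
    using prime by (cases "?p = 0") (auto simp: N_def intro: freshmans_dream')
  have frob_poly: "(a + b) ^ N = a ^ N + b ^ N" for a b :: "'K poly"
  proof (cases "?p = 0")
    case False
    thus ?thesis
      using prime by (intro freshmans_dream') (auto simp: N_def)
  qed (simp add: N_def)
  have "N > 0" using m \<open>n > 0\<close> by (cases "N = 0") auto
  have "\<xi> \<noteq> 0"
    using \<xi> \<open>n > 0\<close> by (auto simp: power_0_left)
  define P where "P = Polynomial.monom 1 m + [:- (\<xi> ^ m):]"
  \<comment> \<open>Expanding (1 - 1)^N by \<open>frob\<close> avoids a parity argument and covers
    characteristic 2.\<close>
  have neg: "(- 1) ^ N = (- 1 :: 'K)"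
  proof -
    have "(1 + - 1 :: 'K) ^ N = 1 + (- 1) ^ N" unfolding frob by simp
    with \<open>N > 0\<close> show ?thesis by (simp add: power_0_left eq_neg_iff_add_eq_0 add.commute)
  qed
  have "(- (\<xi> ^ m)) ^ N = - (\<xi> ^ n)"
    using neg by (simp add: m power_mult power_minus[of "\<xi> ^ m"])
  also have "\<dots> = - ((- 1) ^ (k - 1))"
    using \<xi> assms(1) by (cases k) (simp_all add: eq_neg_iff_add_eq_0)
  finally have P_power: "P ^ N = Polynomial.monom 1 n - [:(- 1) ^ (k - 1):]"
    unfolding P_def frob_poly by (simp add: monom_power poly_const_pow m)
  have "(\<Prod>i<k. [:- (\<xi> * \<zeta> (Suc i)), 1:]) dvd P ^ N"
  proof (rule prod_dvd_if_multiplicity_le)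
    fix a
    \<comment> \<open>Division by \<xi> turns the multiplicity of the node a into that of a / \<xi>
      in the multiset; \<open>Suc\<close> matches zero-based nodes with one-based roots.\<close>
    have "card {i \<in> {..<k}. \<xi> * \<zeta> (Suc i) = a} = card {j \<in> {1..k}. \<zeta> j = a / \<xi>}"
    proof (rule bij_betw_same_card[of Suc])
      show "bij_betw Suc {i \<in> {..<k}. \<xi> * \<zeta> (Suc i) = a} {j \<in> {1..k}. \<zeta> j = a / \<xi>}"
        using \<open>\<xi> \<noteq> 0\<close>
        by (intro bij_betwI[where g = "\<lambda>j. j - 1"]) (auto simp: field_simps)
    qed
    also have "\<dots> = count (image_mset \<zeta> (mset_set {1..k})) (a / \<xi>)"
    proof -
      have "count (image_mset \<zeta> (mset_set {1..k})) (a / \<xi>) =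
          (\<Sum>j | j \<in># mset_set {1..k} \<and> a / \<xi> = \<zeta> j. count (mset_set {1..k}) j)"
        by (rule count_image_mset')
      also have "\<dots> = (\<Sum>j\<in>{j \<in> {1..k}. \<zeta> j = a / \<xi>}. 1)"
        by (rule sum.cong) auto
      finally show ?thesis by simp
    qed
    also have "\<dots> \<le> N"
      using adm by (auto simp: admissible_def N_def)
    finally show "card {i \<in> {..<k}. \<xi> * \<zeta> (Suc i) = a} \<le> N" .
  next
    fix i assume "i \<in> {..<k}"
    hence "\<zeta> (Suc i) ^ n = 1"
      using adm by (auto simp: admissible_def)
    \<comment> \<open>The N-th power map is additive, so this is \<zeta>^n - 1; a field has no
      nilpotents, hence every n-th root of unity is already an m-th root of unity.\<close>
    have "(\<zeta> (Suc i) ^ m + - 1) ^ N = 0"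
      using \<open>\<zeta> (Suc i) ^ n = 1\<close> unfolding frob neg by (simp add: m power_mult)
    hence "\<zeta> (Suc i) ^ m = 1" by simp
    thus "poly P (\<xi> * \<zeta> (Suc i)) = 0"
      by (simp add: P_def poly_monom power_mult_distrib)
  qed simp
  thus ?thesis unfolding P_power .
qed

section \<open>Determinants\<close>

text \<open>The size is a term, not a type, because k varies; entries outside the k by k square are
  ignored.\<close>

definition ldet :: "nat \<Rightarrow> (nat \<Rightarrow> nat \<Rightarrow> 'a::comm_ring_1) \<Rightarrow> 'a" where
  "ldet k A = (\<Sum>p | p permutes {..<k}. of_int (sign p) * (\<Prod>i<k. A i (p i)))"

lemma permutes_less: "p permutes {..<k} \<Longrightarrow> i < k \<Longrightarrow> p i < (k::nat)"
  using permutes_in_image[of p "{..<k}" i] by simp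

lemma ldet_cong:
  assumes "\<And>i l. i < k \<Longrightarrow> l < k \<Longrightarrow> A i l = B i l"
  shows "ldet k A = ldet k B"
  unfolding ldet_def
  by (intro sum.cong refl arg_cong2[where f = "(*)"] prod.cong) (use assms permutes_less in auto)

lemma permutation_if_permutes: "p permutes {..<k::nat} \<Longrightarrow> permutation p"
  unfolding permutation_permutes by blast

lemma ldet_transpose: "ldet k (\<lambda>i l. A l i) = ldet k A"
proof -
  have "ldet k A = (\<Sum>p | p permutes {..<k}. of_int (sign (inv_into UNIV p)) * (\<Prod>i<k. A i (inv_into UNIV p i)))"
    unfolding ldet_def by (rule sum_permutations_inverse)
  also have "\<dots> = (\<Sum>p | p permutes {..<k}. of_int (sign p) * (\<Prod>i<k. A (p i) i))"
  proof (intro sum.cong refl arg_cong2[where f = "(*)"])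
    fix p assume "p \<in> {p. p permutes {..<k}}"
    hence p: "p permutes {..<k}" by simp
    show "of_int (sign (inv_into UNIV p)) = (of_int (sign p) :: 'a)"
      using sign_inverse[OF permutation_if_permutes[OF p]] by simp
    have "(\<Prod>i<k. A i (inv_into UNIV p i)) = (\<Prod>i<k. A (p i) (inv_into UNIV p (p i)))"
      using prod.permute[OF p, of "\<lambda>i. A i (inv_into UNIV p i)"] by (simp add: o_def)
    thus "(\<Prod>i<k. A i (inv_into UNIV p i)) = (\<Prod>i<k. A (p i) i)"
      by (simp add: permutes_inverses[OF p])
  qed
  finally show ?thesis by (simp add: ldet_def)
qed

lemma prod_swap_rows:
  assumes "i < k" "j < k" and p: "p permutes {..<k}"
  shows "(\<Prod>r<k. A (transpose i j r) (p r)) = (\<Prod>r<k. A r ((p \<circ> transpose i j) r))"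
proof -
  have "transpose i j permutes {..<k}"
    using assms by (intro permutes_swap_id) auto
  from prod.permute[OF this, of "\<lambda>r. A (transpose i j r) (p r)"] show ?thesis
    by (simp add: o_def)
qed

lemma ldet_swap_rows:
  assumes "i < k" "j < k" "i \<noteq> j"
  shows "ldet k (\<lambda>r. A (transpose i j r)) = - ldet k A"
proof -
  let ?t = "transpose i j"
  have t: "?t permutes {..<k}"
    using assms by (intro permutes_swap_id) auto
  have "ldet k A = (\<Sum>p | p permutes {..<k}. of_int (sign (p \<circ> ?t)) * (\<Prod>r<k. A r ((p \<circ> ?t) r)))"
    unfolding ldet_def by (rule sum_permutations_compose_right[OF t])
  also have "\<dots> = (\<Sum>p | p permutes {..<k}. - (of_int (sign p) * (\<Prod>r<k. A (?t r) (p r))))"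
  proof (intro sum.cong refl)
    fix p assume "p \<in> {p. p permutes {..<k}}"
    hence p: "p permutes {..<k}" by simp
    have "sign (p \<circ> ?t) = - sign p"
      using sign_compose[OF permutation_if_permutes[OF p] permutation_if_permutes[OF t]] assms(3)
      by (simp add: sign_swap_id)
    thus "of_int (sign (p \<circ> ?t)) * (\<Prod>r<k. A r ((p \<circ> ?t) r)) =
        - (of_int (sign p) * (\<Prod>r<k. A (?t r) (p r)))"
      by (simp only: prod_swap_rows[OF assms(1,2) p]) simp
  qed
  finally show ?thesis by (simp add: ldet_def sum_negf)
qed

text \<open>
  The even and the odd permutations are paired by a transposition; \<open>ldet_swap_rows\<close> would not
  suffice in characteristic \<open>2\<close>.
\<close>

lemma ldet_equal_rows:
  fixes A :: "nat \<Rightarrow> nat \<Rightarrow> 'a::comm_ring_1"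
  assumes "i < k" "j < k" "i \<noteq> j" and eq: "\<And>l. l < k \<Longrightarrow> A i l = A j l"
  shows "ldet k A = 0"
proof -
  let ?t = "transpose i j"
  define f where "f p = of_int (sign p) * (\<Prod>r<k. A r (p r))" for p
  let ?E = "{p. p permutes {..<k} \<and> sign p = 1}" and ?O = "{p. p permutes {..<k} \<and> sign p \<noteq> 1}"
  have t: "?t permutes {..<k}"
    using assms by (intro permutes_swap_id) auto
  have sgn: "sign (p \<circ> ?t) = - sign p" if "p permutes {..<k}" for p
    using sign_compose[OF permutation_if_permutes[OF that] permutation_if_permutes[OF t]] assms(3)
    by (simp add: sign_swap_id)
  have f_swap: "f (p \<circ> ?t) = - f p" if p: "p permutes {..<k}" for p
  proof -
    have "(\<Prod>r<k. A (?t r) (p r)) = (\<Prod>r<k. A r (p r))"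
      using eq permutes_less[OF p] by (intro prod.cong) (auto simp: transpose_def)
    thus ?thesis
      unfolding f_def sgn[OF p] prod_swap_rows[OF assms(1,2) p, symmetric] by simp
  qed
  have odd: "sign p = - 1" if "sign p \<noteq> 1" for p :: "nat \<Rightarrow> nat"
    using that by (cases p rule: sign_cases) auto
  have tt: "p \<circ> ?t \<circ> ?t = p" for p :: "nat \<Rightarrow> nat"
    by (simp add: fun_eq_iff)
  have "sum f ?O = (\<Sum>p\<in>?E. f (p \<circ> ?t))"
    by (rule sum.reindex_bij_witness[where i = "\<lambda>p. p \<circ> ?t" and j = "\<lambda>p. p \<circ> ?t"])
      (use tt sgn odd permutes_compose[OF t] in auto)
  also have "\<dots> = - sum f ?E"
    by (simp add: f_swap sum_negf)
  finally have "sum f ?E + sum f ?O = 0" by simp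
  moreover have "ldet k A = sum f (?E \<union> ?O)"
    unfolding ldet_def f_def by (rule sum.cong) auto
  moreover have "finite {p. p permutes {..<k}}"
    by (rule finite_permutations) simp
  hence "sum f (?E \<union> ?O) = sum f ?E + sum f ?O"
    by (intro sum.union_disjoint) (auto elim: rev_finite_subset)
  ultimately show ?thesis by simp
qed

lemma ldet_scale_rows: "ldet k (\<lambda>i l. c i * A i l) = (\<Prod>i<k. c i) * ldet k A"
  by (simp add: ldet_def prod.distrib sum_distrib_left mult_ac)

text \<open>Multilinearity in all rows at once, from expanding the product of sums in each Leibniz
  term. It serves in \<open>esym_mult_alternant\<close> for the rows and, after transposing, for the
  columns.\<close>

lemma ldet_add_rows:
  "ldet k (\<lambda>i l. A i l + B i l) = (\<Sum>S\<in>Pow {..<k}. ldet k (\<lambda>i. if i \<in> S then A i else B i))"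
proof -
  have expand: "(\<Prod>i<k. A i (p i) + B i (p i)) =
      (\<Sum>S\<in>Pow {..<k}. \<Prod>i<k. (if i \<in> S then A i else B i) (p i))" for p
  proof -
    have "(\<Prod>i<k. A i (p i) + B i (p i)) =
        (\<Sum>S\<in>Pow {..<k}. (\<Prod>i\<in>S. A i (p i)) * (\<Prod>i\<in>{..<k} - S. B i (p i)))"
      by (rule prod_add) simp
    also have "\<dots> = (\<Sum>S\<in>Pow {..<k}. \<Prod>i<k. if i \<in> S then A i (p i) else B i (p i))"
    proof (rule sum.cong[OF refl])
      fix S assume "S \<in> Pow {..<k}"
      hence "{..<k} \<inter> S = S" "{..<k} \<inter> - S = {..<k} - S" by auto
      thus "(\<Prod>i\<in>S. A i (p i)) * (\<Prod>i\<in>{..<k} - S. B i (p i)) =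
          (\<Prod>i<k. if i \<in> S then A i (p i) else B i (p i))"
        by (simp add: prod.If_cases)
    qed
    finally show ?thesis by (simp add: if_distrib[where f = "\<lambda>g. g _"])
  qed
  have "ldet k (\<lambda>i l. A i l + B i l) = (\<Sum>p | p permutes {..<k}. \<Sum>S\<in>Pow {..<k}.
      of_int (sign p) * (\<Prod>i<k. (if i \<in> S then A i else B i) (p i)))"
    unfolding ldet_def expand sum_distrib_left ..
  also have "\<dots> = (\<Sum>S\<in>Pow {..<k}. ldet k (\<lambda>i. if i \<in> S then A i else B i))"
    unfolding ldet_def by (rule sum.swap)
  finally show ?thesis .
qed

lemma ldet_unitriangular:
  assumes "\<And>i l. i < l \<Longrightarrow> l < k \<Longrightarrow> A i l = 0" "\<And>i. i < k \<Longrightarrow> A i i = 1"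
  shows "ldet k A = 1"
proof -
  have "ldet k A = (\<Sum>p\<in>{id}. of_int (sign p) * (\<Prod>i<k. A i (p i)))"
    unfolding ldet_def
  proof (rule sum.mono_neutral_right)
    show "\<forall>p\<in>{p. p permutes {..<k}} - {id}. of_int (sign p) * (\<Prod>i<k. A i (p i)) = 0"
    proof
      fix p assume p: "p \<in> {p. p permutes {..<k}} - {id}"
      \<comment> \<open>A permutation that moves no index upwards is the identity, so every other
        one meets an entry above the diagonal.\<close>
      then obtain i where "i < k" "\<not> p i \<le> i"
        using permutes_natset_le[of p "{..<k}"] by auto
      hence "A i (p i) = 0"
        using assms(1) permutes_less[of p k i] p by simp
      with \<open>i < k\<close> have "(\<Prod>i<k. A i (p i)) = 0"
        by (intro prod_zero) auto
      thus "of_int (sign p) * (\<Prod>i<k. A i (p i)) = 0" by simp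
    qed
  qed (auto simp: finite_permutations permutes_id)
  thus ?thesis by (simp add: assms(2))
qed

section \<open>Divided differences and alternants\<close>

text \<open>Sequences as a module over polynomials, the variable acting as the shift. A polynomial
  that kills a sequence is a linear recurrence for it, and so is each of its multiples.\<close>

definition shift_act :: "'a::comm_ring_1 poly \<Rightarrow> (nat \<Rightarrow> 'a) \<Rightarrow> nat \<Rightarrow> 'a" where
  "shift_act p s a = (\<Sum>i\<le>Polynomial.degree p. Polynomial.coeff p i * s (a + i))"

lemma shift_act_0 [simp]: "shift_act 0 s = (\<lambda>_. 0)"
  by (simp add: shift_act_def fun_eq_iff)

lemma shift_act_pCons [simp]:
  "shift_act (pCons c p) s = (\<lambda>a. c * s a + shift_act p s (Suc a))"
  by (cases "p = 0") (simp_all add: shift_act_def fun_eq_iff sum.atMost_Suc_shift del: sum.atMost_Suc)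

lemma shift_act_zero_seq [simp]: "shift_act p (\<lambda>_. 0) = (\<lambda>_. 0)"
  by (simp add: shift_act_def fun_eq_iff)

lemma shift_act_add: "shift_act (p + q) s = (\<lambda>a. shift_act p s a + shift_act q s a)"
  by (induction p q rule: poly_induct2) (simp_all add: algebra_simps)

lemma shift_act_smult: "shift_act (Polynomial.smult c p) s = (\<lambda>a. c * shift_act p s a)"
  by (induction p) (simp_all add: algebra_simps)

lemma shift_act_mult: "shift_act (p * q) s = shift_act p (shift_act q s)"
  by (induction p) (simp_all add: shift_act_add shift_act_smult)

lemma shift_act_monom: "shift_act (Polynomial.monom 1 n) s = (\<lambda>a. s (a + n))"
  by (induction n) (simp_all add: monom_Suc monom_0)

text \<open>The divided difference of \<open>t\<^sup>a\<close> at the nodes \<open>z 0, \<dots>, z l\<close>, repetitions allowed.\<close>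

primrec divdiff :: "(nat \<Rightarrow> 'a::comm_ring_1) \<Rightarrow> nat \<Rightarrow> nat \<Rightarrow> 'a" where
  "divdiff z 0 l = (if l = 0 then 1 else 0)"
| "divdiff z (Suc a) l = z l * divdiff z a l + (if l = 0 then 0 else divdiff z a (l - 1))"

lemma divdiff_eq_0: "a < l \<Longrightarrow> divdiff z a l = 0"
  by (induction a arbitrary: l) auto

lemma divdiff_diag [simp]: "divdiff z a a = 1"
  by (induction a) (auto simp: divdiff_eq_0)

text \<open>The Leibniz rule for divided differences: the factor t - z_l removes the last node.
  Iterating it down to \<open>z 0\<close> kills the sequence.\<close>

lemma shift_act_divdiff:
  "shift_act [:- z l, 1:] (\<lambda>a. divdiff z a l) = (\<lambda>a. if l = 0 then 0 else divdiff z a (l - 1))"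
  by (simp add: fun_eq_iff)

lemma shift_act_prod_divdiff:
  "shift_act (\<Prod>i\<le>l. [:- z i, 1:]) (\<lambda>a. divdiff z a l) = (\<lambda>_. 0)"
proof (induction l)
  case 0
  show ?case
    using shift_act_divdiff[of z 0] by simp
next
  case (Suc l)
  show ?case
    using shift_act_divdiff[of z "Suc l"] Suc by (simp only: prod.atMost_Suc shift_act_mult) simp
qed

text \<open>Column l satisfies the recurrence given by its own nodes. Their product divides that of
  all k nodes and hence t^n - c.\<close>

lemma divdiff_periodic:
  assumes "(\<Prod>i<k. [:- z i, 1:]) dvd Polynomial.monom 1 n - [:c:]" and "l < k"
  shows "divdiff z (a + n) l = c * divdiff z a l"
proof -
  have "(\<Prod>i\<le>l. [:- z i, 1:]) dvd (\<Prod>i<k. [:- z i, 1:])"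
    using assms(2) by (intro prod_dvd_prod_subset) auto
  from dvd_trans[OF this assms(1)]
  obtain Q where "Polynomial.monom 1 n - [:c:] = Q * (\<Prod>i\<le>l. [:- z i, 1:])"
    unfolding dvd_def by (auto simp: mult.commute)
  moreover have "Polynomial.monom 1 n + [:- c:] = Polynomial.monom 1 n - [:c:]"
    by simp
  ultimately have "shift_act (Polynomial.monom 1 n + [:- c:]) (\<lambda>a. divdiff z a l) =
      shift_act Q (shift_act (\<Prod>i\<le>l. [:- z i, 1:]) (\<lambda>a. divdiff z a l))"
    by (simp only: shift_act_mult)
  hence "shift_act (Polynomial.monom 1 n + [:- c:]) (\<lambda>a. divdiff z a l) = (\<lambda>_. 0)"
    by (simp only: shift_act_prod_divdiff shift_act_zero_seq)
  thus ?thesis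
    by (simp add: shift_act_add shift_act_monom fun_eq_iff)
qed

text \<open>The rows are the Newton coordinates of the powers t^(e i). For distinct nodes this is
  the classical alternant det (z_l^(e i)) divided by the Vandermonde determinant.\<close>

definition alternant :: "nat \<Rightarrow> (nat \<Rightarrow> 'a::comm_ring_1) \<Rightarrow> (nat \<Rightarrow> nat) \<Rightarrow> 'a" where
  "alternant k z e = ldet k (\<lambda>i. divdiff z (e i))"

lemma alternant_cong: "(\<And>i. i < k \<Longrightarrow> e i = e' i) \<Longrightarrow> alternant k z e = alternant k z e'"
  unfolding alternant_def by (intro ldet_cong) simp

lemma alternant_id: "alternant k z (\<lambda>i. i) = 1"
  unfolding alternant_def by (rule ldet_unitriangular) (simp_all add: divdiff_eq_0)

lemma alternant_eq_0: "i < k \<Longrightarrow> j < k \<Longrightarrow> i \<noteq> j \<Longrightarrow> e i = e j \<Longrightarrow> alternant k z e = 0"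
  unfolding alternant_def by (rule ldet_equal_rows[of i k j]) simp_all

text \<open>Row m travels to the front by m adjacent transpositions, each contributing a
  sign.\<close>

lemma alternant_rotate:
  "m < k \<Longrightarrow> alternant k z (\<lambda>i. if i = 0 then e m else if i \<le> m then e (i - 1) else e i) =
    (- 1) ^ m * alternant k z e"
proof (induction m arbitrary: e)
  case 0
  show ?case by (auto intro: alternant_cong)
next
  case (Suc m)
  \<comment> \<open>Exchanging rows m and m + 1 first reduces the rotation by m + 1 steps to one by
    m steps.\<close>
  let ?e = "e \<circ> transpose m (Suc m)"
  have "alternant k z (\<lambda>i. if i = 0 then e (Suc m) else if i \<le> Suc m then e (i - 1) else e i) =
      alternant k z (\<lambda>i. if i = 0 then ?e m else if i \<le> m then ?e (i - 1) else ?e i)"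
    by (rule alternant_cong) (auto simp: transpose_def)
  also have "\<dots> = (- 1) ^ m * alternant k z ?e"
    using Suc.prems by (intro Suc.IH) simp
  also have "alternant k z ?e = - alternant k z e"
    using ldet_swap_rows[of m k "Suc m" "\<lambda>i. divdiff z (e i)"] Suc.prems
    by (simp add: alternant_def)
  finally show ?case by simp
qed

section \<open>Elementary symmetric polynomials and their action on alternants\<close>

definition esym :: "nat \<Rightarrow> nat \<Rightarrow> (nat \<Rightarrow> 'a::comm_ring_1) \<Rightarrow> 'a" where
  "esym k j z = (\<Sum>S | S \<subseteq> {..<k} \<and> card S = j. \<Prod>i\<in>S. z i)"

text \<open>Subsets correspond to 0/1 exponent vectors, and c^i comes out by homogeneity.
  Extensionality of the vectors outside {1..k} makes the correspondence bijective.\<close>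

lemma esym_eq_sum_exponents:
  fixes \<zeta> :: "nat \<Rightarrow> 'a::comm_ring_1"
  shows "esym k i (\<lambda>l. c * \<zeta> (Suc l)) =
    c ^ i * (\<Sum>e | e \<in> {1..k} \<rightarrow>\<^sub>E {0, 1::nat} \<and> (\<Sum>j=1..k. e j) = i. \<Prod>j=1..k. \<zeta> j ^ e j)"
proof -
  have "esym k i (\<lambda>l. c * \<zeta> (Suc l)) =
      (\<Sum>S | S \<subseteq> {..<k} \<and> card S = i. c ^ i * (\<Prod>l\<in>S. \<zeta> (Suc l)))"
    unfolding esym_def by (intro sum.cong) (auto simp: prod.distrib)
  also have "\<dots> = c ^ i * (\<Sum>S | S \<subseteq> {..<k} \<and> card S = i. \<Prod>l\<in>S. \<zeta> (Suc l))"
    by (simp add: sum_distrib_left)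
  also have "(\<Sum>S | S \<subseteq> {..<k} \<and> card S = i. \<Prod>l\<in>S. \<zeta> (Suc l)) =
      (\<Sum>e | e \<in> {1..k} \<rightarrow>\<^sub>E {0, 1::nat} \<and> (\<Sum>j=1..k. e j) = i. \<Prod>j=1..k. \<zeta> j ^ e j)"
  proof (rule sum.reindex_bij_witness[where
        j = "\<lambda>S. \<lambda>j\<in>{1..k}. if j \<in> Suc ` S then 1 else 0" and i = "\<lambda>e. {l. l < k \<and> e (Suc l) = 1}"])
    fix S assume S: "S \<in> {S. S \<subseteq> {..<k} \<and> card S = i}"
    let ?e = "\<lambda>j\<in>{1..k}. if j \<in> Suc ` S then 1 else (0::nat)"
    show "{l. l < k \<and> ?e (Suc l) = 1} = S"
      using S by (auto simp: restrict_def split: if_splits)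
    have int: "{1..k} \<inter> Suc ` S = Suc ` S" using S by auto
    have "(\<Sum>j=1..k. ?e j) = (\<Sum>j=1..k. if j \<in> Suc ` S then 1 else 0)"
      by (intro sum.cong) auto
    also have "\<dots> = card S"
      using int by (simp add: sum.If_cases card_image)
    finally show "?e \<in> {e. e \<in> {1..k} \<rightarrow>\<^sub>E {0, 1} \<and> (\<Sum>j=1..k. e j) = i}"
      using S by auto
    have "(\<Prod>j=1..k. \<zeta> j ^ ?e j) = (\<Prod>j=1..k. if j \<in> Suc ` S then \<zeta> j else 1)"
      by (intro prod.cong) auto
    also have "\<dots> = (\<Prod>l\<in>S. \<zeta> (Suc l))"
      using int by (simp add: prod.If_cases prod.reindex)
    finally show "(\<Prod>j=1..k. \<zeta> j ^ ?e j) = (\<Prod>l\<in>S. \<zeta> (Suc l))" .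
  next
    fix e assume e: "e \<in> {e. e \<in> {1..k} \<rightarrow>\<^sub>E {0, 1::nat} \<and> (\<Sum>j=1..k. e j) = i}"
    let ?S = "{l. l < k \<and> e (Suc l) = 1}"
    have PiE: "e \<in> {1..k} \<rightarrow>\<^sub>E {0, 1::nat}" and sum_e: "(\<Sum>j=1..k. e j) = i"
      using e by blast+
    have val: "e j = 0 \<or> e j = 1" if "j \<in> {1..k}" for j
      using PiE_mem[OF PiE that] by blast
    have eq: "e j = (if j \<in> Suc ` ?S then 1 else 0)" if "j \<in> {1..k}" for j
      using val[OF that] that by (cases j) auto
    show "(\<lambda>j\<in>{1..k}. if j \<in> Suc ` ?S then 1 else 0) = e"
    proof (rule ext)
      fix j
      show "(\<lambda>j\<in>{1..k}. if j \<in> Suc ` ?S then 1 else 0) j = e j"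
        using eq[of j] PiE_arb[OF PiE, of j] by (cases "j \<in> {1..k}") simp_all
    qed
    have int: "{1..k} \<inter> Suc ` ?S = Suc ` ?S" by auto
    have "i = (\<Sum>j=1..k. if j \<in> Suc ` ?S then 1 else 0)"
      unfolding sum_e[symmetric] by (rule sum.cong[OF refl eq])
    also have "\<dots> = card ?S"
      using int by (simp add: sum.If_cases card_image)
    finally show "?S \<in> {S. S \<subseteq> {..<k} \<and> card S = i}"
      by auto
  qed
  finally show ?thesis .
qed

lemma coeff_subset_sum:
  "Polynomial.coeff (\<Sum>S\<in>Pow {..<k::nat}. Polynomial.monom (f S) (card S)) j =
    (\<Sum>S | S \<subseteq> {..<k} \<and> card S = j. f S)"
proof -
  have "Polynomial.coeff (\<Sum>S\<in>Pow {..<k}. Polynomial.monom (f S) (card S)) j =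
      (\<Sum>S\<in>Pow {..<k}. if card S = j then f S else 0)"
    by (simp add: Polynomial.coeff_sum)
  also have "\<dots> = (\<Sum>S\<in>{S \<in> Pow {..<k}. card S = j}. f S)"
    by (rule sum.inter_filter[symmetric]) simp
  finally show ?thesis by simp
qed

text \<open>The generating function of \<open>esym\<close>: \<open>[:1, z i:]\<close> is 1 + x z_i,
  so the left side is det (1 + x T).\<close>

lemma prod_linear_expand:
  fixes z :: "nat \<Rightarrow> 'a::comm_ring_1"
  shows "(\<Prod>i<k. [:1, z i:]) = (\<Sum>S\<in>Pow {..<k}. Polynomial.monom (\<Prod>i\<in>S. z i) (card S))"
proof -
  have "(\<Prod>i\<in>S. Polynomial.monom (z i) 1) = Polynomial.monom (\<Prod>i\<in>S. z i) (card S)"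
    if "finite S" for S
    using that by induction (simp_all add: mult_monom monom_0)
  moreover have "(\<Prod>i<k. [:1, z i:]) = (\<Prod>i<k. Polynomial.monom (z i) 1 + 1)"
    by (intro prod.cong refl) (simp add: monom_Suc monom_0 one_pCons)
  moreover have "\<dots> = (\<Sum>S\<in>Pow {..<k}. \<Prod>i\<in>S. Polynomial.monom (z i) 1)"
    by (subst prod_add) simp_all
  ultimately show ?thesis
    by (auto intro!: sum.cong dest: finite_subset)
qed

lemma ldet_const_poly: "ldet k (\<lambda>i l. [:A i l:]) = [:ldet k A:]"
proof -
  have const_prod: "(\<Prod>i<m. [:f i:]) = [:\<Prod>i<m. f i:]" for f :: "nat \<Rightarrow> 'a" and m
    by (induction m) (simp_all add: one_pCons)
  have const_sum: "(\<Sum>x\<in>S. [:f x:]) = [:sum f S:]" for f :: "(nat \<Rightarrow> nat) \<Rightarrow> 'a" and S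
    by (induction S rule: infinite_finite_induct) simp_all
  show ?thesis
    unfolding ldet_def by (simp add: const_prod const_sum of_int_poly mult.commute)
qed

text \<open>
  Multiplication by \<open>1 + x t\<close> turns the column \<open>u l\<close> of divided differences at
  \<open>z 0, \<dots>, z l\<close> into \<open>(1 + x z l) u l + x u (l - 1)\<close>. The determinant of the new columns is
  expanded by rows on one side and by columns on the other, where only the choice of the first
  summand in every column survives.
\<close>

lemma esym_mult_alternant:
  fixes z :: "nat \<Rightarrow> 'a::comm_ring_1"
  shows "esym k j z * alternant k z e =
    (\<Sum>S | S \<subseteq> {..<k} \<and> card S = j. alternant k z (\<lambda>i. if i \<in> S then Suc (e i) else e i))"
proof -
  let ?x = "Polynomial.monom 1 1 :: 'a poly"
  define u :: "nat \<Rightarrow> nat \<Rightarrow> 'a poly" where "u i l = [:divdiff z (e i) l:]" for i l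
  \<comment> \<open>Row i of P holds the coordinates of (1 + x t) t^(e i).\<close>
  define P where "P i l = ?x * [:divdiff z (Suc (e i)) l:] + u i l" for i l
  have "ldet k P = (\<Sum>S\<in>Pow {..<k}.
      ldet k (\<lambda>i. if i \<in> S then \<lambda>l. ?x * [:divdiff z (Suc (e i)) l:] else u i))"
    unfolding P_def by (rule ldet_add_rows)
  also have "\<dots> = (\<Sum>S\<in>Pow {..<k}. Polynomial.monom
      (alternant k z (\<lambda>i. if i \<in> S then Suc (e i) else e i)) (card S))"
  proof (rule sum.cong[OF refl])
    fix S assume "S \<in> Pow {..<k}"
    hence int: "{..<k} \<inter> S = S" by auto
    have "ldet k (\<lambda>i. if i \<in> S then \<lambda>l. ?x * [:divdiff z (Suc (e i)) l:] else u i) =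
        ldet k (\<lambda>i l. (if i \<in> S then ?x else 1) * [:divdiff z (if i \<in> S then Suc (e i) else e i) l:])"
      by (rule ldet_cong) (simp add: u_def)
    also have "\<dots> = (\<Prod>i<k. if i \<in> S then ?x else 1) *
        [:alternant k z (\<lambda>i. if i \<in> S then Suc (e i) else e i):]"
      unfolding ldet_scale_rows ldet_const_poly alternant_def ..
    also have "(\<Prod>i<k. if i \<in> S then ?x else 1) = Polynomial.monom 1 (card S)"
      using int by (simp add: prod.If_cases monom_power)
    finally show "ldet k (\<lambda>i. if i \<in> S then \<lambda>l. ?x * [:divdiff z (Suc (e i)) l:] else u i) =
        Polynomial.monom (alternant k z (\<lambda>i. if i \<in> S then Suc (e i) else e i)) (card S)"
      by (simp add: smult_monom)
  qed
  also have "ldet k P = (\<Prod>l<k. [:1, z l:]) * [:alternant k z e:]"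
  proof -
    define c where "c R l = (if l \<in> R then [:1, z l:] else if l = 0 then 0 else ?x)" for R l
    define w where "w R l i = (if l \<in> R \<or> l = 0 then u i l else u i (l - 1))" for R l i
    have P: "P i l = [:1, z l:] * u i l + (if l = 0 then 0 else ?x) * u i (l - 1)" for i l
      by (simp add: P_def u_def monom_Suc monom_0)
    have zero: "ldet k (\<lambda>l i. c R l * w R l i) = 0" if R: "R \<in> Pow {..<k} - {{..<k}}" for R
    proof -
      \<comment> \<open>The first column that takes the second summand. For m = 0 that summand is 0;
        otherwise column m - 1 takes its first summand, and both columns are multiples of u (m -
        1).\<close>
      define m where "m = (LEAST l. l < k \<and> l \<notin> R)"
      have "\<exists>l. l < k \<and> l \<notin> R" using R by auto
      from LeastI_ex[OF this] have m: "m < k" "m \<notin> R" by (auto simp: m_def)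
      show ?thesis
      proof (cases "m = 0")
        case True
        hence "(\<Prod>l<k. c R l) = 0"
          using m by (intro prod_zero) (auto simp: c_def intro!: bexI[of _ 0])
        thus ?thesis by (simp add: ldet_scale_rows)
      next
        case False
        hence "m - 1 \<in> R"
          using not_less_Least[of "m - 1" "\<lambda>l. l < k \<and> l \<notin> R"] m by (auto simp: m_def)
        hence "ldet k (w R) = 0"
          using m False by (intro ldet_equal_rows[of "m - 1" k m]) (auto simp: w_def)
        thus ?thesis by (simp add: ldet_scale_rows)
      qed
    qed
    \<comment> \<open>Transposing makes the row expansion available for columns.\<close>
    have "ldet k P = ldet k (\<lambda>l i. [:1, z l:] * u i l + (if l = 0 then 0 else ?x) * u i (l - 1))"
      using ldet_transpose[of k P] by (simp only: P)
    also have "\<dots> = (\<Sum>R\<in>Pow {..<k}. ldet k (\<lambda>l. if l \<in> R then \<lambda>i. [:1, z l:] * u i l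
        else (\<lambda>i. (if l = 0 then 0 else ?x) * u i (l - 1))))"
      by (rule ldet_add_rows)
    also have "\<dots> = (\<Sum>R\<in>Pow {..<k}. ldet k (\<lambda>l i. c R l * w R l i))"
      by (intro sum.cong refl ldet_cong) (simp add: c_def w_def)
    also have "\<dots> = (\<Sum>R\<in>{{..<k}}. ldet k (\<lambda>l i. c R l * w R l i))"
      by (rule sum.mono_neutral_right) (use zero in auto)
    also have "\<dots> = (\<Prod>l<k. c {..<k} l) * ldet k (w {..<k})"
      by (simp add: ldet_scale_rows)
    also have "(\<Prod>l<k. c {..<k} l) = (\<Prod>l<k. [:1, z l:])"
      by (rule prod.cong) (auto simp: c_def)
    also have "ldet k (w {..<k}) = ldet k (\<lambda>l i. u i l)"
      by (rule ldet_cong) (simp add: w_def)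
    also have "\<dots> = [:alternant k z e:]"
      unfolding ldet_transpose[of k u] alternant_def ldet_const_poly[symmetric]
      by (rule ldet_cong) (simp add: u_def)
    finally show ?thesis .
  qed
  finally have eq: "(\<Prod>l<k. [:1, z l:]) * [:alternant k z e:] = (\<Sum>S\<in>Pow {..<k}.
    Polynomial.monom (alternant k z (\<lambda>i. if i \<in> S then Suc (e i) else e i)) (card S))" .
  have "Polynomial.coeff ((\<Prod>l<k. [:1, z l:]) * [:alternant k z e:]) j = esym k j z * alternant k z e"
    by (simp add: prod_linear_expand coeff_subset_sum esym_def mult.commute)
  thus ?thesis
    unfolding eq coeff_subset_sum by simp
qed

text \<open>There are k + 1 rows. Moving the last one to the front costs (-1)^k, and replacing t^n
  by (-1)^k t^0 there gives the same sign again.\<close>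

lemma alternant_cycle:
  fixes z :: "nat \<Rightarrow> 'a::comm_ring_1"
  assumes "\<And>l. l \<le> k \<Longrightarrow> divdiff z n l = (- 1) ^ k * divdiff z 0 l" "e k = n"
  shows "alternant (Suc k) z e = alternant (Suc k) z (\<lambda>i. if i = 0 then 0 else e (i - 1))"
proof -
  let ?e = "\<lambda>i. if i = 0 then n else e (i - 1)" and ?f = "\<lambda>i. if i = 0 then 0 else e (i - 1)"
  let ?c = "\<lambda>i. if i = 0 then (- 1) ^ k else (1 :: 'a)"
  have "(- 1) ^ k * alternant (Suc k) z e = alternant (Suc k) z ?e"
    unfolding alternant_rotate[of k "Suc k" z e, OF lessI, symmetric]
    by (rule alternant_cong) (use assms(2) in auto)
  also have "\<dots> = ldet (Suc k) (\<lambda>i l. ?c i * divdiff z (?f i) l)"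
    unfolding alternant_def
    by (rule ldet_cong) (use assms(1) in \<open>auto simp: less_Suc_eq_le simp del: divdiff.simps\<close>)
  also have "\<dots> = (- 1) ^ k * alternant (Suc k) z ?f"
    unfolding ldet_scale_rows alternant_def by (simp add: prod.lessThan_Suc_shift)
  finally have "(- 1) ^ k * ((- 1) ^ k * alternant (Suc k) z e) =
      (- 1) ^ k * ((- 1) ^ k * alternant (Suc k) z ?f)" by simp
  thus ?thesis
    by (simp flip: mult.assoc power_mult_distrib)
qed

section \<open>The quantum Pieri rule for alternants\<close>

text \<open>The rows are numbered from the bottom, which makes the exponents increasing.\<close>

definition exps :: "nat \<Rightarrow> nat list \<Rightarrow> nat \<Rightarrow> nat" where
  "exps k D i = D ! (k - 1 - i) + i"

text \<open>The inverse of \<open>exps\<close> on increasing exponents; by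
  \<open>increasing_ge\<close> the truncated subtraction is exact there.\<close>

definition diagram_of :: "nat \<Rightarrow> (nat \<Rightarrow> nat) \<Rightarrow> nat list" where
  "diagram_of k e = map (\<lambda>r. e (k - 1 - r) - (k - 1 - r)) [0..<k]"

definition increasing :: "nat \<Rightarrow> (nat \<Rightarrow> nat) \<Rightarrow> bool" where
  "increasing k e \<longleftrightarrow> (\<forall>i. Suc i < k \<longrightarrow> e i < e (Suc i))"

lemma increasing_less:
  assumes "increasing k e" "i < j" "j < k"
  shows "e i < e j"
  using assms(2,3)
proof (induction j)
  case (Suc j)
  from Suc.prems assms(1) have "e j < e (Suc j)"
    by (auto simp: increasing_def)
  with Suc show ?case
    by (cases "i = j") auto
qed simp

lemma increasing_ge:
  assumes "increasing k e" "i < k"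
  shows "i \<le> e i"
  using assms(2)
proof (induction i)
  case (Suc i)
  with assms(1) have "e i < e (Suc i)"
    by (auto simp: increasing_def)
  with Suc show ?case by simp
qed simp

lemma length_diagram_of [simp]: "length (diagram_of k e) = k"
  by (simp add: diagram_of_def)

lemma exps_diagram_of:
  assumes "increasing k e" "i < k"
  shows "exps k (diagram_of k e) i = e i"
proof -
  have "k - 1 - (k - 1 - i) = i" using assms(2) by simp
  thus ?thesis
    using increasing_ge[OF assms] assms(2) by (simp add: exps_def diagram_of_def)
qed

lemma nth_eq_exps:
  assumes "r < k"
  shows "D ! r + (k - 1 - r) = exps k D (k - 1 - r)"
proof -
  have "k - 1 - (k - 1 - r) = r" using assms by simp
  thus ?thesis by (simp add: exps_def)
qed

lemma diagram_eqI:
  assumes "length D = k" "length E = k" "\<And>i. i < k \<Longrightarrow> exps k D i = exps k E i"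
  shows "D = E"
proof (rule nth_equalityI)
  fix r assume "r < length D"
  hence "r < k" "k - 1 - r < k" using assms(1) by auto
  have "D ! r + (k - 1 - r) = E ! r + (k - 1 - r)"
    unfolding nth_eq_exps[OF \<open>r < k\<close>] by (rule assms(3)[OF \<open>k - 1 - r < k\<close>])
  thus "D ! r = E ! r" by (rule add_right_imp_eq)
qed (use assms in simp)

lemma sum_list_exps:
  assumes "length D = k"
  shows "sum_list D + \<Sum>{..<k} = sum (exps k D) {..<k}"
proof -
  have "sum_list D = (\<Sum>i<k. D ! i)"
    using assms by (simp add: sum_list_sum_nth atLeast0LessThan)
  also have "\<dots> = (\<Sum>i<k. D ! (k - 1 - i))"
    by (rule sum.reindex_bij_witness[where i = "\<lambda>i. k - 1 - i" and j = "\<lambda>i. k - 1 - i"]) auto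
  finally show ?thesis
    by (simp add: exps_def sum.distrib)
qed

text \<open>Adding the row index turns weak monotonicity into strict, and the width bound n - k for
  the top row into the bound n for the largest exponent.\<close>

lemma diagrams_iff_exps:
  assumes "1 \<le> k" "k < n"
  shows "D \<in> diagrams k n \<longleftrightarrow>
    length D = k \<and> increasing k (exps k D) \<and> (\<forall>i<k. exps k D i < n)"
proof safe
  assume D: "D \<in> diagrams k n"
  thus "length D = k" by (simp add: diagrams_def)
  show "increasing k (exps k D)"
    unfolding increasing_def
  proof (intro allI impI)
    fix i assume "Suc i < k"
    moreover from this have "D ! (k - 1 - i) \<le> D ! (k - 1 - Suc i)"
      using D by (auto simp: diagrams_def)
    ultimately show "exps k D i < exps k D (Suc i)"
      by (simp add: exps_def)
  qed
  fix i assume "i < k"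
  hence "D ! (k - 1 - i) \<le> n - k"
    using D by (auto simp: diagrams_def)
  thus "exps k D i < n"
    using assms \<open>i < k\<close> by (simp add: exps_def)
next
  assume D: "k = length D" "increasing (length D) (exps (length D) D)" "\<forall>i<length D. exps (length D) D i < n"
  have le: "D ! j \<le> D ! i" if "i \<le> j" "j < k" for i j
    using that
  proof (induction j rule: dec_induct)
    case (step j)
    have "increasing k (exps k D)" using D by simp
    moreover define m where "m = k - 1 - Suc j"
    hence m: "k - 1 - Suc j = m" "k - 1 - j = Suc m" "Suc m < k"
      using step.prems by simp_all
    ultimately have "exps k D m < exps k D (Suc m)"
      by (simp add: increasing_def)
    hence "D ! Suc j \<le> D ! j"
      using nth_eq_exps[of "Suc j" k D] nth_eq_exps[of j k D] step.prems unfolding m by linarith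
    with step show ?case by simp
  qed simp
  have "exps k D (k - 1) < n" using D assms by simp
  hence "D ! 0 \<le> n - k" using assms by (simp add: exps_def)
  hence "D ! i \<le> n - k" if "i < k" for i
    using le[of 0 i] that by simp
  with D le show "D \<in> diagrams (length D) n" by (simp add: diagrams_def)
qed

lemma pieri_classical_iff_exps:
  assumes "1 \<le> k" "k < n" "D \<in> diagrams k n"
  shows "D' \<in> pieri_classical k n j D \<longleftrightarrow> D' \<in> diagrams k n \<and>
    sum (exps k D') {..<k} = sum (exps k D) {..<k} + j \<and>
    (\<forall>i<k. exps k D i \<le> exps k D' i \<and> exps k D' i \<le> Suc (exps k D i))"
proof -
  have *: "(\<forall>i<k. D ! i \<le> D' ! i \<and> D' ! i \<le> D ! i + 1) \<longleftrightarrow>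
      (\<forall>i<k. exps k D i \<le> exps k D' i \<and> exps k D' i \<le> Suc (exps k D i))" (is "?L \<longleftrightarrow> ?R")
  proof
    assume ?L thus ?R by (simp add: exps_def)
  next
    assume R: ?R
    show ?L
    proof (intro allI impI)
      fix i assume "i < k"
      with R have "exps k D (k - 1 - i) \<le> exps k D' (k - 1 - i) \<and>
          exps k D' (k - 1 - i) \<le> Suc (exps k D (k - 1 - i))" by simp
      thus "D ! i \<le> D' ! i \<and> D' ! i \<le> D ! i + 1"
        using nth_eq_exps[OF \<open>i < k\<close>, of D] nth_eq_exps[OF \<open>i < k\<close>, of D'] by linarith
    qed
  qed
  have "length D = k" using assms(3) by (simp add: diagrams_def)
  moreover have "length D' = k" if "D' \<in> diagrams k n" using that by (simp add: diagrams_def)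
  ultimately have "sum_list D' = sum_list D + j \<longleftrightarrow>
      sum (exps k D') {..<k} = sum (exps k D) {..<k} + j" if "D' \<in> diagrams k n"
    using sum_list_exps[of D k] sum_list_exps[of D' k] that by linarith
  thus ?thesis
    unfolding pieri_classical_def mem_Collect_eq * by blast
qed

text \<open>The upward shift raises the index counted from the bottom by one. So a row that loses a
  box keeps its exponent, and a row that loses none gains 1. A full top row has exponent n - 1.
  Since j <= k < n, the subtraction n - j is exact.\<close>

lemma pieri_quantum_iff_exps:
  assumes "1 \<le> k" "k < n" "D \<in> diagrams k n" "j \<le> k"
  shows "D' \<in> pieri_quantum k n j D \<longleftrightarrow> D' \<in> diagrams k n \<and>
    Suc (exps k D (k - 1)) = n \<and> sum (exps k D') {..<k} + n = sum (exps k D) {..<k} + j \<and>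
    exps k D' 0 = 0 \<and>
    (\<forall>i. Suc i < k \<longrightarrow> exps k D i \<le> exps k D' (Suc i) \<and> exps k D' (Suc i) \<le> Suc (exps k D i))"
proof -
  have *: "(\<forall>i. i + 1 < k \<longrightarrow> D' ! i \<le> D ! (i + 1) \<and> D ! (i + 1) \<le> D' ! i + 1) \<longleftrightarrow>
      (\<forall>i. Suc i < k \<longrightarrow> exps k D i \<le> exps k D' (Suc i) \<and> exps k D' (Suc i) \<le> Suc (exps k D i))"
    (is "?L \<longleftrightarrow> ?R")
  proof
    assume L: ?L
    show ?R
    proof (intro allI impI)
      fix i assume i: "Suc i < k"
      hence "(k - 1 - Suc i) + 1 = k - 1 - i" by simp
      with L[rule_format, of "k - 1 - Suc i"] i
      show "exps k D i \<le> exps k D' (Suc i) \<and> exps k D' (Suc i) \<le> Suc (exps k D i)"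
        by (simp add: exps_def)
    qed
  next
    assume R: ?R
    show ?L
    proof (intro allI impI)
      fix i assume i: "i + 1 < k"
      define m where "m = k - 1 - (i + 1)"
      hence m: "k - 1 - (i + 1) = m" "k - 1 - i = Suc m" "Suc m < k"
        using i by simp_all
      have "D' ! i + Suc m = exps k D' (Suc m)" "D ! (i + 1) + m = exps k D m"
        using nth_eq_exps[of i k D'] nth_eq_exps[of "i + 1" k D] i unfolding m by linarith+
      moreover have "exps k D m \<le> exps k D' (Suc m)" "exps k D' (Suc m) \<le> Suc (exps k D m)"
        using R m(3) by blast+
      ultimately show "D' ! i \<le> D ! (i + 1) \<and> D ! (i + 1) \<le> D' ! i + 1"
        by linarith
    qed
  qed
  have "length D = k" using assms(3) by (simp add: diagrams_def)
  moreover have "length D' = k" if "D' \<in> diagrams k n" using that by (simp add: diagrams_def)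
  ultimately have "sum_list D' + (n - j) = sum_list D \<longleftrightarrow>
      sum (exps k D') {..<k} + n = sum (exps k D) {..<k} + j" if "D' \<in> diagrams k n"
    using sum_list_exps[of D k] sum_list_exps[of D' k] that assms(2,4) by linarith
  moreover have "D ! 0 = n - k \<longleftrightarrow> Suc (exps k D (k - 1)) = n"
    using assms(1,2) by (auto simp: exps_def)
  moreover have "D' ! (k - 1) = 0 \<longleftrightarrow> exps k D' 0 = 0" by (simp add: exps_def)
  ultimately show ?thesis
    unfolding pieri_quantum_def mem_Collect_eq * by blast
qed

definition schubert_value :: "nat \<Rightarrow> (nat \<Rightarrow> 'a::comm_ring_1) \<Rightarrow> nat list \<Rightarrow> 'a" where
  "schubert_value k z D = alternant k z (exps k D)"

lemma schubert_value_empty: "schubert_value k z (empty_diagram k) = 1"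
proof -
  have "alternant k z (exps k (empty_diagram k)) = alternant k z (\<lambda>i. i)"
    by (rule alternant_cong) (simp add: exps_def empty_diagram_def)
  thus ?thesis by (simp add: schubert_value_def alternant_id)
qed

abbreviation bump :: "nat set \<Rightarrow> (nat \<Rightarrow> nat) \<Rightarrow> nat \<Rightarrow> nat" where
  "bump S e \<equiv> \<lambda>i. if i \<in> S then Suc (e i) else e i"

lemma sum_bump:
  assumes "S \<subseteq> {..<k}"
  shows "sum (bump S e) {..<k} = sum e {..<k} + card S"
proof -
  have "sum (bump S e) {..<k} = (\<Sum>i<k. e i + (if i \<in> S then 1 else 0))"
    by (intro sum.cong) auto
  moreover have "(\<Sum>i<k. if i \<in> S then 1 else (0::nat)) = card ({..<k} \<inter> S)"
    by (simp add: sum.If_cases)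
  moreover have "{..<k} \<inter> S = S" using assms by auto
  ultimately show ?thesis by (simp add: sum.distrib)
qed

text \<open>
  Among the terms of \<open>esym_mult_alternant\<close>, those with two equal exponents vanish and those
  with largest exponent below \<open>n\<close> form the classical part. A largest exponent \<open>n\<close> is cycled to a
  smallest exponent \<open>0\<close>; this gives the quantum part, unless \<open>0\<close> occurs already.
\<close>

lemma schubert_value_pieri:
  fixes z :: "nat \<Rightarrow> 'a::comm_ring_1"
  assumes k: "1 \<le> k" "k < n" and j: "j \<le> k" and D: "D \<in> diagrams k n"
    and per: "\<And>l. l < k \<Longrightarrow> divdiff z n l = (- 1) ^ (k - 1) * divdiff z 0 l"
  shows "esym k j z * schubert_value k z D =
    (\<Sum>D'\<in>pieri_classical k n j D. schubert_value k z D') +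
    (\<Sum>D'\<in>pieri_quantum k n j D. schubert_value k z D')"
proof -
  define e where "e = exps k D"
  have e: "increasing k e" "\<And>i. i < k \<Longrightarrow> e i < n" and [simp]: "length D = k"
    using D by (auto simp: diagrams_iff_exps[OF k] e_def)
  have last: "Suc (k - 1) = k" using k by simp
  define Y where "Y = {S. S \<subseteq> {..<k} \<and> card S = j}"
  define A where "A = {S \<in> Y. increasing k (bump S e) \<and> bump S e (k - 1) < n}"
  \<comment> \<open>The last condition excludes the sets whose cycled exponents would contain 0
    twice.\<close>
  define B where "B = {S \<in> Y. increasing k (bump S e) \<and> bump S e (k - 1) = n \<and> 0 < bump S e 0}"
  define rot :: "nat set \<Rightarrow> nat \<Rightarrow> nat" where
    "rot S = (\<lambda>i. if i = 0 then 0 else bump S e (i - 1))" for S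
  have rot_0: "rot S 0 = 0" and rot_Suc: "rot S (Suc i) = bump S e i" for S i
    by (simp_all add: rot_def)
  have cycle: "alternant k z (bump S e) = alternant k z (rot S)" if "bump S e (k - 1) = n" for S
  proof -
    have "alternant (Suc (k - 1)) z (bump S e) =
        alternant (Suc (k - 1)) z (\<lambda>i. if i = 0 then 0 else bump S e (i - 1))"
    proof (rule alternant_cycle[where n = n])
      fix l assume "l \<le> k - 1"
      hence "l < k" using k(1) by linarith
      thus "divdiff z n l = (- 1) ^ (k - 1) * divdiff z 0 l" by (rule per)
    qed (fact that)
    thus ?thesis unfolding last rot_def .
  qed
  have "finite Y"
    unfolding Y_def by (rule finite_subset[of _ "Pow {..<k}"]) auto
  have zero: "alternant k z (bump S e) = 0" if "S \<in> Y - (A \<union> B)" for S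
  proof (cases "increasing k (bump S e)")
    case False
    then obtain i where i: "Suc i < k" "\<not> bump S e i < bump S e (Suc i)"
      by (auto simp: increasing_def)
    moreover have "e i < e (Suc i)"
      using e(1) i by (auto simp: increasing_def)
    \<comment> \<open>Strictly increasing exponents, each raised by at most 1, can fail to increase
      only by becoming equal.\<close>
    ultimately have "bump S e i = bump S e (Suc i)"
      by (auto split: if_splits)
    thus ?thesis
      using i by (intro alternant_eq_0[of i k "Suc i"]) auto
  next
    case True
    with that have "\<not> bump S e (k - 1) < n" and B: "bump S e (k - 1) = n \<Longrightarrow> bump S e 0 = 0"
      by (auto simp: A_def B_def)
    moreover have "e (k - 1) < n" using e(2)[of "k - 1"] k by simp
    ultimately have n: "bump S e (k - 1) = n"
      by (auto split: if_splits)
    \<comment> \<open>With a single row the exponent n is also the lowest one, so it cannot be 0;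
      hence rows 0 and 1 below exist.\<close>
    have "k \<noteq> 1"
    proof
      assume "k = 1"
      hence "k - 1 = 0" by simp
      with n have "bump S e 0 = n" by (simp only:)
      with B[OF n] k show False by linarith
    qed
    hence "alternant k z (rot S) = 0"
      using B[OF n] k by (intro alternant_eq_0[of 0 k 1]) (auto simp: rot_def)
    thus ?thesis using cycle[OF n] by simp
  qed
  have "esym k j z * schubert_value k z D = (\<Sum>S\<in>Y. alternant k z (bump S e))"
    unfolding schubert_value_def e_def Y_def by (rule esym_mult_alternant)
  also have "\<dots> = (\<Sum>S\<in>A \<union> B. alternant k z (bump S e))"
  proof (rule sum.mono_neutral_right[OF \<open>finite Y\<close>])
    show "A \<union> B \<subseteq> Y" unfolding A_def B_def by blast
  qed (use zero in blast)
  also have "\<dots> = (\<Sum>S\<in>A. alternant k z (bump S e)) + (\<Sum>S\<in>B. alternant k z (bump S e))"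
  proof (rule sum.union_disjoint)
    show "finite A" "finite B"
      using \<open>finite Y\<close> unfolding A_def B_def by simp_all
    show "A \<inter> B = {}" unfolding A_def B_def using less_not_refl by blast
  qed
  also have "(\<Sum>S\<in>A. alternant k z (bump S e)) =
      (\<Sum>D'\<in>pieri_classical k n j D. schubert_value k z D')"
  proof (rule sum.reindex_bij_witness[where
        j = "\<lambda>S. diagram_of k (bump S e)" and i = "\<lambda>D'. {i. i < k \<and> exps k D' i = Suc (e i)}"])
    fix S assume "S \<in> A"
    hence S: "S \<subseteq> {..<k}" "card S = j" "increasing k (bump S e)" "bump S e (k - 1) < n"
      by (auto simp: A_def Y_def)
    have ex: "exps k (diagram_of k (bump S e)) i = bump S e i" if "i < k" for i
      using exps_diagram_of[OF S(3) that] .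
    show "{i. i < k \<and> exps k (diagram_of k (bump S e)) i = Suc (e i)} = S"
      using S(1) ex by (auto split: if_splits)
    have less: "bump S e i < n" if "i < k" for i
    proof (cases "i = k - 1")
      case False
      with that have "bump S e i < bump S e (k - 1)"
        by (intro increasing_less[OF S(3)]) auto
      with S(4) show ?thesis by linarith
    qed (use S(4) in \<open>simp only:\<close>)
    have "increasing k (exps k (diagram_of k (bump S e)))"
      using S(3) ex by (simp add: increasing_def)
    moreover have "sum (exps k (diagram_of k (bump S e))) {..<k} = sum e {..<k} + j"
      using sum_bump[OF S(1)] S(2) ex by simp
    ultimately show "diagram_of k (bump S e) \<in> pieri_classical k n j D"
      using ex less by (auto simp: pieri_classical_iff_exps[OF k D] diagrams_iff_exps[OF k] e_def)
    show "schubert_value k z (diagram_of k (bump S e)) = alternant k z (bump S e)"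
      unfolding schubert_value_def by (rule alternant_cong) (rule ex)
  next
    fix D' assume "D' \<in> pieri_classical k n j D"
    hence D': "length D' = k" "increasing k (exps k D')" "\<And>i. i < k \<Longrightarrow> exps k D' i < n"
      "sum (exps k D') {..<k} = sum e {..<k} + j"
      "\<And>i. i < k \<Longrightarrow> e i \<le> exps k D' i" "\<And>i. i < k \<Longrightarrow> exps k D' i \<le> Suc (e i)"
      by (auto simp: pieri_classical_iff_exps[OF k D] diagrams_iff_exps[OF k] e_def)
    define S where "S = {i. i < k \<and> exps k D' i = Suc (e i)}"
    have bump: "bump S e i = exps k D' i" if "i < k" for i
      using D'(5,6)[OF that] that by (auto simp: S_def)
    have S: "S \<subseteq> {..<k}" by (auto simp: S_def)
    have inc: "increasing k (bump S e)"
      using D'(2) bump by (simp add: increasing_def)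
    have "sum (bump S e) {..<k} = sum e {..<k} + j"
      using bump D'(4) by simp
    hence "card S = j" using sum_bump[OF S, of e] by simp
    thus "S \<in> A"
      using S inc bump[of "k - 1"] D'(3)[of "k - 1"] k unfolding A_def Y_def mem_Collect_eq by simp
    show "diagram_of k (bump S e) = D'"
      by (rule diagram_eqI[of _ k]) (simp_all add: D'(1) exps_diagram_of[OF inc] bump)
  qed
  also have "(\<Sum>S\<in>B. alternant k z (bump S e)) =
      (\<Sum>D'\<in>pieri_quantum k n j D. schubert_value k z D')"
  \<comment> \<open>The exponent n can only arise from n - 1, so k - 1 belongs to every S in B; the
    other members are read off one index higher, because of the cycling.\<close>
  proof (rule sum.reindex_bij_witness[where
        j = "\<lambda>S. diagram_of k (rot S)" and
        i = "\<lambda>D'. insert (k - 1) {i. Suc i < k \<and> exps k D' (Suc i) = Suc (e i)}"])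
    fix S assume "S \<in> B"
    hence S: "S \<subseteq> {..<k}" "card S = j" "increasing k (bump S e)" "bump S e (k - 1) = n" "0 < bump S e 0"
      by (auto simp: B_def Y_def)
    have inc: "increasing k (rot S)"
      unfolding increasing_def
    proof (intro allI impI)
      fix i assume i: "Suc i < k"
      show "rot S i < rot S (Suc i)"
      proof (cases i)
        case 0
        with S(5) show ?thesis by (simp only: rot_0 rot_Suc)
      next
        case (Suc m)
        with i have "bump S e m < bump S e (Suc m)"
          by (intro increasing_less[OF S(3)]) auto
        with Suc show ?thesis by (simp only: rot_Suc)
      qed
    qed
    have ex: "exps k (diagram_of k (rot S)) i = rot S i" if "i < k" for i
      using exps_diagram_of[OF inc that] .
    have "e (k - 1) < n" using e(2)[of "k - 1"] k by simp
    hence last_in: "k - 1 \<in> S" "Suc (e (k - 1)) = n"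
      using S(4) by (auto split: if_splits)
    have ex_Suc: "exps k (diagram_of k (rot S)) (Suc i) = bump S e i" if "Suc i < k" for i
      using ex[OF that] by (simp only: rot_Suc)
    show "insert (k - 1) {i. Suc i < k \<and> exps k (diagram_of k (rot S)) (Suc i) = Suc (e i)} = S"
    proof (rule Set.set_eqI)
      fix i
      show "i \<in> insert (k - 1) {i. Suc i < k \<and> exps k (diagram_of k (rot S)) (Suc i) = Suc (e i)} \<longleftrightarrow>
          i \<in> S"
      proof (cases "Suc i < k")
        case True
        thus ?thesis using ex_Suc[OF True] by auto
      next
        case False
        hence "i \<in> S \<Longrightarrow> i = k - 1" using S(1) by auto
        with False last_in(1) show ?thesis by blast
      qed
    qed
    have less: "rot S i < n" if "i < k" for i
    proof (cases i)
      case (Suc i')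
      with that have "bump S e i' < bump S e (k - 1)"
        by (intro increasing_less[OF S(3)]) auto
      with S(4) Suc show ?thesis by (simp only: rot_Suc)
    qed (use k in \<open>simp add: rot_0\<close>)
    have "sum (rot S) {..<k} + n = sum (bump S e) {..<k}"
    proof -
      have "sum (rot S) {..<Suc (k - 1)} = sum (bump S e) {..<k - 1}"
        by (simp only: sum.lessThan_Suc_shift rot_0 rot_Suc add_0)
      moreover have "sum (bump S e) {..<Suc (k - 1)} = sum (bump S e) {..<k - 1} + n"
        by (simp only: sum.lessThan_Suc S(4))
      ultimately show ?thesis unfolding last by simp
    qed
    hence "sum (exps k (diagram_of k (rot S))) {..<k} + n = sum e {..<k} + j"
      using sum_bump[OF S(1), of e] S(2) ex by simp
    moreover have "increasing k (exps k (diagram_of k (rot S)))"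
      using inc ex by (simp add: increasing_def)
    moreover have "exps k (diagram_of k (rot S)) i < n" if "i < k" for i
      using less[OF that] ex[OF that] by simp
    moreover have "exps k (diagram_of k (rot S)) 0 = 0"
      using ex[of 0] rot_0 k by simp
    moreover have "e i \<le> exps k (diagram_of k (rot S)) (Suc i)"
      "exps k (diagram_of k (rot S)) (Suc i) \<le> Suc (e i)" if "Suc i < k" for i
      using ex_Suc[OF that] by simp_all
    ultimately show "diagram_of k (rot S) \<in> pieri_quantum k n j D"
      unfolding pieri_quantum_iff_exps[OF k D j] diagrams_iff_exps[OF k] e_def[symmetric]
      using last_in(2) length_diagram_of by blast
    show "schubert_value k z (diagram_of k (rot S)) = alternant k z (bump S e)"
      unfolding schubert_value_def cycle[OF S(4)] by (rule alternant_cong) (rule ex)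
  next
    fix D' assume "D' \<in> pieri_quantum k n j D"
    hence D': "length D' = k" "increasing k (exps k D')" "\<And>i. i < k \<Longrightarrow> exps k D' i < n"
      "sum (exps k D') {..<k} + n = sum e {..<k} + j" "exps k D' 0 = 0" "Suc (e (k - 1)) = n"
      "\<And>i. Suc i < k \<Longrightarrow> e i \<le> exps k D' (Suc i)"
      "\<And>i. Suc i < k \<Longrightarrow> exps k D' (Suc i) \<le> Suc (e i)"
      by (auto simp: pieri_quantum_iff_exps[OF k D j] diagrams_iff_exps[OF k] e_def)
    define S where "S = insert (k - 1) {i. Suc i < k \<and> exps k D' (Suc i) = Suc (e i)}"
    have S: "S \<subseteq> {..<k}" using k by (auto simp: S_def)
    have bump: "bump S e i = exps k D' (Suc i)" if "Suc i < k" for i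
      using D'(7,8)[OF that] that by (auto simp: S_def)
    have "k - 1 \<in> S" by (simp add: S_def)
    hence bump_last: "bump S e (k - 1) = n"
      using D'(6) by (simp only: if_True)
    have rot: "rot S i = exps k D' i" if "i < k" for i
    proof (cases i)
      case (Suc m)
      with that bump[of m] show ?thesis by (simp only: rot_Suc)
    qed (use D'(5) in \<open>simp add: rot_0\<close>)
    have inc_rot: "increasing k (rot S)"
      using D'(2) rot by (simp add: increasing_def)
    have inc: "increasing k (bump S e)"
      unfolding increasing_def
    proof (intro allI impI)
      fix i assume i: "Suc i < k"
      show "bump S e i < bump S e (Suc i)"
      proof (cases "Suc (Suc i) < k")
        case True
        hence "exps k D' (Suc i) < exps k D' (Suc (Suc i))"
          using D'(2) by (auto simp: increasing_def)
        thus ?thesis unfolding bump[OF i] bump[OF True] .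
      next
        case False
        hence eq: "Suc i = k - 1" using i by simp
        show ?thesis
          unfolding bump[OF i] unfolding eq bump_last using D'(3)[of "k - 1"] k by simp
      qed
    qed
    have "0 < bump S e 0"
    proof (cases "k = 1")
      case True
      hence "k - 1 = 0" by simp
      with bump_last have "bump S e 0 = n" by (simp only:)
      with k show ?thesis by linarith
    next
      case False
      hence "exps k D' 0 < exps k D' (Suc 0)" "Suc 0 < k"
        using D'(2) k by (auto simp: increasing_def)
      thus ?thesis unfolding bump[OF \<open>Suc 0 < k\<close>] by simp
    qed
    have "sum (rot S) {..<k} + n = sum (bump S e) {..<k}"
    proof -
      have "sum (rot S) {..<Suc (k - 1)} = sum (bump S e) {..<k - 1}"
        by (simp only: sum.lessThan_Suc_shift rot_0 rot_Suc add_0)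
      moreover have "sum (bump S e) {..<Suc (k - 1)} = sum (bump S e) {..<k - 1} + n"
        by (simp only: sum.lessThan_Suc bump_last)
      ultimately show ?thesis unfolding last by simp
    qed
    hence "sum (bump S e) {..<k} = sum e {..<k} + j"
      using rot D'(4) by simp
    hence "card S = j" using sum_bump[OF S, of e] by simp
    thus "S \<in> B"
      using S inc bump_last \<open>0 < bump S e 0\<close> unfolding B_def Y_def mem_Collect_eq by blast
    show "diagram_of k (rot S) = D'"
      by (rule diagram_eqI[of _ k]) (simp_all add: D'(1) exps_diagram_of[OF inc_rot] rot)
  qed
  finally show ?thesis .
qed

section \<open>Functionals on the quantum cohomology ring\<close>

lemma finite_diagrams: "finite (diagrams k n)"
proof (rule finite_subset)
  show "diagrams k n \<subseteq> {xs. set xs \<subseteq> {..n - k} \<and> length xs = k}"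
    by (auto simp: diagrams_def in_set_conv_nth)
qed (rule finite_lists_length_eq, simp)

lemma pieri_subset:
  "pieri_classical k n j D \<subseteq> diagrams k n" "pieri_quantum k n j D \<subseteq> diagrams k n"
  by (auto simp: pieri_classical_def pieri_quantum_def)

lemmas finite_pieri = pieri_subset[THEN finite_subset, OF finite_diagrams]

lemma empty_diagram_in_diagrams: "empty_diagram k \<in> diagrams k n"
  by (simp add: empty_diagram_def diagrams_def)

lemma column_in_diagrams: "j \<le> k \<Longrightarrow> k < n \<Longrightarrow> column k j \<in> diagrams k n"
  by (auto simp: column_def diagrams_def nth_append)

lemma schubert_in_free_module: "D \<in> diagrams k n \<Longrightarrow> schubert D \<in> free_module k n"
  by (auto simp: schubert_def free_module_def)

lemma free_module_zero: "(\<lambda>_. 0) \<in> free_module k n"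
  by (simp add: free_module_def)

lemma free_module_add:
  fixes a b :: "nat list \<Rightarrow> 'a::monoid_add"
  shows "a \<in> free_module k n \<Longrightarrow> b \<in> free_module k n \<Longrightarrow> (\<lambda>D. a D + b D) \<in> free_module k n"
  by (simp add: free_module_def)

lemma free_module_scale:
  fixes a :: "nat list \<Rightarrow> 'a::mult_zero"
  shows "a \<in> free_module k n \<Longrightarrow> scale c a \<in> free_module k n"
  by (simp add: free_module_def scale_def)

lemma free_module_induct [consumes 1, case_names zero add]:
  fixes b :: "nat list \<Rightarrow> 'a::comm_ring_1"
  assumes "b \<in> free_module k n"
    and "P (\<lambda>_. 0)"
    and "\<And>a c D. a \<in> free_module k n \<Longrightarrow> P a \<Longrightarrow> D \<in> diagrams k n \<Longrightarrow>
      P (\<lambda>E. a E + scale c (schubert D) E)"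
  shows "P b"
proof -
  have "P (\<lambda>E. if E \<in> S then b E else 0)" if "finite S" "S \<subseteq> diagrams k n" for S
    using that
  proof induction
    case (insert D S)
    have "(\<lambda>E. if E \<in> insert D S then b E else 0) =
        (\<lambda>E. (if E \<in> S then b E else 0) + scale (b D) (schubert D) E)"
      using insert by (auto simp: schubert_def scale_def fun_eq_iff)
    moreover have "(\<lambda>E. if E \<in> S then b E else 0) \<in> free_module k n"
      using assms(1) by (simp add: free_module_def)
    ultimately show ?case
      using insert assms(3) by simp
  qed (simp add: assms(2))
  from this[OF finite_diagrams subset_refl]
  have "P (\<lambda>E. if E \<in> diagrams k n then b E else 0)" .
  also have "(\<lambda>E. if E \<in> diagrams k n then b E else 0) = b"
    using assms(1) by (auto simp: free_module_def fun_eq_iff)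
  finally show ?thesis .
qed

text \<open>The additive extension of v to the free module over Z[q] with q set to 1.\<close>

definition specialize :: "nat \<Rightarrow> nat \<Rightarrow> (nat list \<Rightarrow> 'a::comm_ring_1) \<Rightarrow> (nat list \<Rightarrow> int poly) \<Rightarrow> 'a" where
  "specialize k n v a = (\<Sum>D\<in>diagrams k n. of_int (poly (a D) 1) * v D)"

lemma specialize_zero: "specialize k n v (\<lambda>_. 0) = 0"
  by (simp add: specialize_def)

lemma specialize_add:
  "specialize k n v (\<lambda>D. a D + b D) = specialize k n v a + specialize k n v b"
  by (simp add: specialize_def algebra_simps sum.distrib)

lemma specialize_scale:
  "specialize k n v (scale c a) = of_int (poly c 1) * specialize k n v a"
  by (simp add: specialize_def scale_def sum_distrib_left mult.assoc)

lemma specialize_schubert: "D \<in> diagrams k n \<Longrightarrow> specialize k n v (schubert D) = v D"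
  by (simp add: specialize_def schubert_def if_distrib[where f = "\<lambda>p. poly p _"]
      if_distrib[where f = of_int] if_distrib[where f = "\<lambda>c. c * _"] finite_diagrams cong: if_cong)

lemma specialize_sum:
  "finite S \<Longrightarrow> specialize k n v (\<lambda>E. \<Sum>D\<in>S. f D E) = (\<Sum>D\<in>S. specialize k n v (f D))"
  by (induction rule: finite_induct) (simp_all add: specialize_zero specialize_add)

text \<open>The tie-breaker of the induction measure among diagrams with equally many boxes.\<close>

definition empty_rows :: "nat list \<Rightarrow> nat" where
  "empty_rows D = card {i. i < length D \<and> D ! i = 0}"

text \<open>
  The diagram \<open>D0\<close> is \<open>D\<close> without its first column, whose height is \<open>j\<close>.
\<close>

lemma strip_column:
  assumes k: "1 \<le> k" "k < n" and D: "D \<in> diagrams k n" "D \<noteq> empty_diagram k"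
  obtains j D0 where "1 \<le> j" "j \<le> k" "D0 \<in> diagrams k n" "sum_list D0 < sum_list D"
    "D \<in> pieri_classical k n j D0"
    "\<And>D'. D' \<in> pieri_classical k n j D0 \<Longrightarrow> D' \<noteq> D \<Longrightarrow>
      sum_list D' = sum_list D \<and> empty_rows D' < empty_rows D"
    "\<And>D'. D' \<in> pieri_quantum k n j D0 \<Longrightarrow> sum_list D' < sum_list D"
proof -
  have len: "length D = k" and mono: "\<And>i j. i \<le> j \<Longrightarrow> j < k \<Longrightarrow> D ! j \<le> D ! i"
    using D(1) by (auto simp: diagrams_def)
  \<comment> \<open>The disjunct \<open>k \<le> i\<close> gives j = k when no row is empty and keeps
    the search within the list.\<close>
  define j where "j = (LEAST i. k \<le> i \<or> D ! i = 0)"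
  have j: "k \<le> j \<or> D ! j = 0"
    unfolding j_def by (rule LeastI[of _ k]) simp
  have "j \<le> k"
    unfolding j_def by (rule Least_le) simp
  have nz: "D ! i \<noteq> 0 \<longleftrightarrow> i < j" if "i < k" for i
  proof
    assume "i < j"
    with not_less_Least[of i] that show "D ! i \<noteq> 0" unfolding j_def by fastforce
  next
    assume "D ! i \<noteq> 0"
    show "i < j"
    proof (rule ccontr)
      assume "\<not> i < j"
      with j that mono[of j i] \<open>D ! i \<noteq> 0\<close> show False by auto
    qed
  qed
  have "1 \<le> j"
  proof (rule ccontr)
    assume "\<not> 1 \<le> j"
    with nz have "D = replicate k 0" by (intro nth_equalityI) (auto simp: len)
    with D(2) show False by (simp add: empty_diagram_def)
  qed
  define D0 where "D0 = map (\<lambda>r. r - 1) D"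
  have D0: "length D0 = k" "\<And>i. i < k \<Longrightarrow> D0 ! i = D ! i - 1"
    by (auto simp: D0_def len)
  have sum_nth: "sum_list E = (\<Sum>i<k. E ! i)" if "length E = k" for E :: "nat list"
    using that by (simp add: sum_list_sum_nth atLeast0LessThan)
  have "sum_list D = (\<Sum>i<k. D0 ! i + (if i < j then 1 else 0))"
    unfolding sum_nth[OF len]
  proof (rule sum.cong[OF refl])
    fix i assume "i \<in> {..<k}"
    with nz[of i] D0(2)[of i] show "D ! i = D0 ! i + (if i < j then 1 else 0)" by auto
  qed
  moreover have "(\<Sum>i<k. if i < j then 1 else (0::nat)) = j"
  proof -
    have "{..<k} \<inter> {i. i < j} = {..<j}" using \<open>j \<le> k\<close> by auto
    thus ?thesis by (simp add: sum.If_cases)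
  qed
  ultimately have sum_D: "sum_list D = sum_list D0 + j"
    by (simp add: sum.distrib sum_nth[OF D0(1)])
  have D0_in: "D0 \<in> diagrams k n"
    using D(1) D0 by (auto simp: diagrams_def intro: diff_le_mono le_trans[OF diff_le_self])
  have D_in: "D \<in> pieri_classical k n j D0"
    using D(1) sum_D D0 by (auto simp: pieri_classical_def)
  have classical: "sum_list D' = sum_list D \<and> empty_rows D' < empty_rows D"
    if D': "D' \<in> pieri_classical k n j D0" "D' \<noteq> D" for D'
  proof
    have D'_in: "length D' = k" "\<And>i j. i \<le> j \<Longrightarrow> j < k \<Longrightarrow> D' ! j \<le> D' ! i"
      using D'(1) by (auto simp: pieri_classical_def diagrams_def)
    have le: "D' ! i \<le> D0 ! i + 1" if "i < k" for i
      using D'(1) that by (auto simp: pieri_classical_def)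
    show sum: "sum_list D' = sum_list D"
      using D'(1) sum_D by (simp add: pieri_classical_def)
    \<comment> \<open>If D' had no box from row j on, it would lie inside D; having as many boxes,
      it would equal D.\<close>
    obtain i where i: "j \<le> i" "i < k" "D' ! i \<noteq> 0"
    proof (rule ccontr)
      assume "\<not> thesis"
      with that have 0: "D' ! i = 0" if "j \<le> i" "i < k" for i
        using that by blast
      have "D' ! i \<le> D ! i" if "i < k" for i
        using 0[of i] le[OF that] nz[OF that] D0(2)[OF that] that by (cases "i < j") auto
      hence "D' ! i = D ! i" if "i < k" for i
        using sum that unfolding sum_nth[OF len] sum_nth[OF D'_in(1)]
        by (intro sum_mono_inv[of "(!) D'" "{..<k}" "(!) D"]) auto
      hence "D' = D"
        by (intro nth_equalityI) (auto simp: len D'_in(1))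
      with D'(2) show False by simp
    qed
    have pos: "D' ! i' \<noteq> 0" if "i' \<le> i" for i'
      using D'_in(2)[OF that i(2)] i(3) by simp
    have "{i. i < k \<and> D' ! i = 0} \<subset> {i. i < k \<and> D ! i = 0}"
    proof
      show "{i. i < k \<and> D' ! i = 0} \<subseteq> {i. i < k \<and> D ! i = 0}"
      proof safe
        fix l assume l: "l < k" "D' ! l = 0"
        hence "\<not> l < j" using pos[of l] i(1) by auto
        thus "D ! l = 0" using nz[OF l(1)] by simp
      qed
      have "j < k" using i by simp
      hence "j \<in> {i. i < k \<and> D ! i = 0}" "j \<notin> {i. i < k \<and> D' ! i = 0}"
        using pos[OF i(1)] nz[of j] by simp_all
      thus "{i. i < k \<and> D' ! i = 0} \<noteq> {i. i < k \<and> D ! i = 0}"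
        by metis
    qed
    thus "empty_rows D' < empty_rows D"
      unfolding empty_rows_def len D'_in(1) by (intro psubset_card_mono) simp_all
  qed
  have quantum: "sum_list D' < sum_list D" if "D' \<in> pieri_quantum k n j D0" for D'
    using that sum_D \<open>1 \<le> j\<close> by (auto simp: pieri_quantum_def)
  have "sum_list D0 < sum_list D"
    using sum_D \<open>1 \<le> j\<close> by simp
  from that[OF \<open>1 \<le> j\<close> \<open>j \<le> k\<close> D0_in this D_in classical quantum] show thesis .
qed

lemma specialize_pieri:
  assumes "quantum_cup_product k n star" "1 \<le> j" "j \<le> k" "D \<in> diagrams k n"
  shows "specialize k n v (star (schubert (column k j)) (schubert D)) =
    (\<Sum>D'\<in>pieri_classical k n j D. v D') + (\<Sum>D'\<in>pieri_quantum k n j D. v D')"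
  using pieri_subset[of k n j D] unfolding quantum_cup_product.pieri[OF assms] specialize_add
  by (simp add: specialize_sum finite_pieri specialize_scale specialize_schubert subset_iff
      cong: sum.cong)

text \<open>
  The elements on which the functional is multiplicative form a subalgebra \<open>G\<close>. It contains the
  columns, which generate the ring by \<open>strip_column\<close>.
\<close>

lemma specialize_star_schubert:
  fixes v :: "nat list \<Rightarrow> 'a::comm_ring_1"
  assumes Q: "quantum_cup_product k n star"
    and kn: "1 \<le> k" "k < n"
    and one: "v (empty_diagram k) = 1"
    and pieri_v: "\<And>j D. 1 \<le> j \<Longrightarrow> j \<le> k \<Longrightarrow> D \<in> diagrams k n \<Longrightarrow>
      x j * v D = (\<Sum>D'\<in>pieri_classical k n j D. v D') + (\<Sum>D'\<in>pieri_quantum k n j D. v D')"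
    and D: "D \<in> diagrams k n" and b: "b \<in> free_module k n"
  shows "specialize k n v (star (schubert D) b) = v D * specialize k n v b"
proof -
  note closed = quantum_cup_product.closed[OF Q] and commute = quantum_cup_product.commute[OF Q]
    and assoc = quantum_cup_product.assoc[OF Q] and unit = quantum_cup_product.unit[OF Q]
    and add_left = quantum_cup_product.add_left[OF Q]
    and scale_left = quantum_cup_product.scale_left[OF Q]
    and pieri = quantum_cup_product.pieri[OF Q]
  have add_right: "star a (\<lambda>D. b D + c D) = (\<lambda>D. star a b D + star a c D)"
    if "a \<in> free_module k n" "b \<in> free_module k n" "c \<in> free_module k n" for a b c
    using add_left[OF that(2,3,1)] that by (simp add: commute[of a] free_module_add)
  have scale_right: "star a (scale r b) = scale r (star a b)"
    if "a \<in> free_module k n" "b \<in> free_module k n" for a b r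
    using scale_left[OF that(2,1)] that by (simp add: commute[of a] free_module_scale)
  have zero_left: "star (\<lambda>_. 0) a = (\<lambda>_. 0)" if "a \<in> free_module k n" for a
    using scale_left[OF free_module_zero that, of 0] by (simp add: scale_def)
  let ?A = "free_module k n :: (nat list \<Rightarrow> int poly) set"
  let ?ev = "specialize k n v"
  define G where "G = {a \<in> ?A. \<forall>b\<in>?A. ?ev (star a b) = ?ev a * ?ev b}"
  have G_zero: "(\<lambda>_. 0) \<in> G"
    by (simp add: G_def free_module_zero zero_left specialize_zero)
  have G_add: "(\<lambda>D. a D + b D) \<in> G" if "a \<in> G" "b \<in> G" for a b
    using that by (auto simp: G_def free_module_add add_left specialize_add algebra_simps)
  have G_scale: "scale c a \<in> G" if "a \<in> G" for a c
    using that by (auto simp: G_def free_module_scale scale_left specialize_scale mult.assoc)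
  have G_star: "star a b \<in> G" if "a \<in> G" "b \<in> G" for a b
    using that by (auto simp: G_def closed assoc mult.assoc)
  have G_sum: "(\<lambda>E. \<Sum>D\<in>S. f D E) \<in> G" if "finite S" "\<And>D. D \<in> S \<Longrightarrow> f D \<in> G" for S f
    using that by (induction rule: finite_induct) (simp_all add: G_zero G_add)
  have G_one: "schubert (empty_diagram k) \<in> G"
    by (simp add: G_def unit schubert_in_free_module empty_diagram_in_diagrams
        specialize_schubert one)
  have col: "schubert (column k j) \<in> G" if j: "1 \<le> j" "j \<le> k" for j
  proof -
    let ?x = "schubert (column k j) :: nat list \<Rightarrow> int poly"
    have x: "?x \<in> ?A"
      using j kn by (intro schubert_in_free_module column_in_diagrams)
    have ev: "?ev (star ?x (schubert D)) = x j * v D" if "D \<in> diagrams k n" for D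
      by (simp only: specialize_pieri[OF Q j that] pieri_v[OF j that])
    have "?ev (star ?x b) = x j * ?ev b" if "b \<in> ?A" for b
      using that
    proof (induction b rule: free_module_induct)
      case zero
      show ?case
        using x by (simp add: commute[OF x free_module_zero] zero_left specialize_zero)
    next
      case (add a c D)
      thus ?case
        using x by (simp add: add_right free_module_scale schubert_in_free_module scale_right
            specialize_add specialize_scale ev specialize_schubert algebra_simps)
    qed
    \<comment> \<open>Taking the unit for b identifies the value of the column itself.\<close>
    moreover from this[of "schubert (empty_diagram k)"] have "?ev ?x = x j"
      by (simp add: commute[OF x] unit x schubert_in_free_module empty_diagram_in_diagrams
          specialize_schubert one)
    ultimately show ?thesis
      using x by (simp add: G_def)
  qed
  have "schubert D \<in> G"
    using D
  proof (induction D rule: wf_induct_rule[OF wf_measures[of "[sum_list, empty_rows]"]])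
    case (1 D)
    show ?case
    proof (cases "D = empty_diagram k")
      case False
      then obtain j D0 where j: "1 \<le> j" "j \<le> k" and D0: "D0 \<in> diagrams k n"
        and less: "sum_list D0 < sum_list D"
        and D_in: "D \<in> pieri_classical k n j D0"
        and less_c: "\<And>D'. D' \<in> pieri_classical k n j D0 \<Longrightarrow> D' \<noteq> D \<Longrightarrow>
          sum_list D' = sum_list D \<and> empty_rows D' < empty_rows D"
        and less_q: "\<And>D'. D' \<in> pieri_quantum k n j D0 \<Longrightarrow> sum_list D' < sum_list D"
        using strip_column[OF kn 1(2)] by metis
      let ?C = "pieri_classical k n j D0 - {D}" and ?Q = "pieri_quantum k n j D0"
      let ?q = "scale [:0, 1:] :: (nat list \<Rightarrow> int poly) \<Rightarrow> nat list \<Rightarrow> int poly"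
      \<comment> \<open>The Pieri rule for D0 solved for D, which occurs in it with coefficient 1;
        all other terms are smaller in the measure.\<close>
      have "schubert D = (\<lambda>E. (star (schubert (column k j)) (schubert D0) E +
          scale (- 1) (\<lambda>E. \<Sum>D'\<in>?C. schubert D' E) E) +
          scale (- 1) (\<lambda>E. \<Sum>D'\<in>?Q. ?q (schubert D') E) E)"
        unfolding pieri[OF j D0] by (simp add: sum.remove[OF finite_pieri(1) D_in] scale_def)
      moreover have "\<dots> \<in> G"
      proof (intro G_add G_star G_scale G_sum col j)
        show "schubert D0 \<in> G"
          using less D0 by (intro 1) simp_all
        show "schubert D' \<in> G" if "D' \<in> ?C" for D'
          using that less_c[of D'] pieri_subset(1)[of k n j D0] by (intro 1) auto
        show "schubert D' \<in> G" if "D' \<in> ?Q" for D'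
          using that less_q[of D'] pieri_subset(2)[of k n j D0] by (intro 1) auto
      qed (simp_all add: finite_pieri)
      ultimately show ?thesis by simp
    qed (simp add: G_one)
  qed
  with b D show ?thesis
    by (simp add: G_def specialize_schubert)
qed


section \<open>Specialization of the coefficients\<close>

text \<open>At q = 1 all powers of q, negative ones included, become 1, so only the sum of the
  coefficients remains.\<close>

definition laurent_eval :: "('f::zero \<Rightarrow> 'K::comm_monoid_add) \<Rightarrow> (int \<Rightarrow>\<^sub>0 'f) \<Rightarrow> 'K" where
  "laurent_eval \<iota> p = (\<Sum>m\<in>Poly_Mapping.keys p. \<iota> (Poly_Mapping.lookup p m))"

abbreviation type_ring_hom :: "('a::comm_ring_1 \<Rightarrow> 'b::comm_ring_1) \<Rightarrow> bool" where
  "type_ring_hom f \<equiv> f \<in> ring_hom ring_of_type_algebra ring_of_type_algebra"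

lemma type_ring_hom_iff:
  "type_ring_hom f \<longleftrightarrow>
    (\<forall>a b. f (a + b) = f a + f b) \<and> (\<forall>a b. f (a * b) = f a * f b) \<and> f 1 = 1"
  by (auto simp: ring_hom_def ring_of_type_algebra_def)

lemma type_ring_hom_simps:
  assumes "type_ring_hom f"
  shows "f (a + b) = f a + f b" "f (a * b) = f a * f b" "f 1 = 1" "f 0 = 0"
    "f (of_nat i) = of_nat i" "f (of_int m) = of_int m" "f (sum g S) = (\<Sum>x\<in>S. f (g x))"
proof -
  show add: "f (a + b) = f a + f b" and "f (a * b) = f a * f b" and one: "f 1 = 1" for a b
    using assms by (simp_all add: type_ring_hom_iff)
  show zero: "f 0 = 0"
    using add[of 0 0] by (metis add.right_neutral add_left_cancel)
  show nat: "f (of_nat i) = of_nat i" for i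
    by (induction i) (simp_all add: add one zero)
  have "f (- of_nat i) = - of_nat i" for i
    using add[of "- of_nat i" "of_nat i"] by (simp add: zero nat eq_neg_iff_add_eq_0)
  with nat show "f (of_int m) = of_int m"
    by (cases m rule: int_cases2) simp_all
  show "f (sum g S) = (\<Sum>x\<in>S. f (g x))"
    by (induction S rule: infinite_finite_induct) (simp_all add: zero add)
qed

lemma laurent_eval_single:
  "\<iota> 0 = 0 \<Longrightarrow> laurent_eval \<iota> (Poly_Mapping.single m c) = \<iota> c"
  by (simp add: laurent_eval_def)

lemma laurent_induct [case_names zero add]:
  fixes p :: "int \<Rightarrow>\<^sub>0 'f::field"
  assumes "P 0" "\<And>p m c. P p \<Longrightarrow> P (Poly_Mapping.single m c + p)"
  shows "P p"
proof (induction p rule: update_induct)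
  case (update f a b)
  have "Poly_Mapping.update a b f = Poly_Mapping.single a b + f"
    using update(1)
    by (intro poly_mapping_eqI) (auto simp: lookup_update lookup_add lookup_single when_def in_keys_iff)
  with update assms(2) show ?case by simp
qed (fact assms(1))

lemma type_ring_hom_laurent_eval:
  fixes \<iota> :: "'f::field \<Rightarrow> 'K::field"
  assumes "type_ring_hom \<iota>"
  shows "type_ring_hom (laurent_eval \<iota>)"
proof -
  note \<iota> = type_ring_hom_simps[OF assms]
  have add: "laurent_eval \<iota> (p + q) = laurent_eval \<iota> p + laurent_eval \<iota> q" for p q
    unfolding laurent_eval_def
    by (rule setsum_keys_plus_distrib[of "\<lambda>_. \<iota>"]) (simp_all add: \<iota>)
  have zero: "laurent_eval \<iota> 0 = 0"
    by (simp add: laurent_eval_def)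
  have "laurent_eval \<iota> (p * q) = laurent_eval \<iota> p * laurent_eval \<iota> q" for p q
  proof (induction p rule: laurent_induct)
    case p: (add p m c)
    have "laurent_eval \<iota> (Poly_Mapping.single m c * q) = \<iota> c * laurent_eval \<iota> q"
      by (induction q rule: laurent_induct)
        (simp_all add: zero add laurent_eval_single mult_single \<iota> algebra_simps)
    with p show ?case
      by (simp add: add laurent_eval_single \<iota> distrib_right)
  qed (simp add: zero)
  moreover have "laurent_eval \<iota> 1 = 1"
    using laurent_eval_single[of \<iota> 0 1] by (simp add: \<iota>)
  ultimately show ?thesis
    using add by (simp add: type_ring_hom_iff)
qed

lemma laurent_eval_q: "type_ring_hom \<iota> \<Longrightarrow> laurent_eval \<iota> laurent_q = 1"
  by (simp add: laurent_q_def laurent_eval_single type_ring_hom_simps)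

lemma laurent_eval_base_change:
  fixes \<iota> :: "'f::field \<Rightarrow> 'K::field"
  assumes "type_ring_hom \<iota>"
  shows "laurent_eval \<iota> (base_change r) = of_int (poly r 1)"
  unfolding base_change_def
  by (induction r) (simp_all add: map_poly_pCons laurent_eval_q[OF assms]
      type_ring_hom_simps[OF type_ring_hom_laurent_eval[OF assms]])

text \<open>A unit cannot be sent to 0, so \<open>of_nat m\<close> vanishes in both fields or in
  neither. This transfers admissibility, stated with the characteristic of F, to polynomials over
  K.\<close>

lemma CHAR_eq_of_type_ring_hom:
  fixes \<iota> :: "'f::field \<Rightarrow> 'K::field"
  assumes "type_ring_hom \<iota>"
  shows "CHAR('K) = CHAR('f)"
proof (rule CHAR_eqI)
  note \<iota> = type_ring_hom_simps[OF assms]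
  show "of_nat CHAR('f) = (0 :: 'K)"
    using \<iota>(5)[of "CHAR('f)"] by (simp add: \<iota>(4))
  fix m assume "of_nat m = (0 :: 'K)"
  hence 0: "\<iota> (of_nat m) = 0" by (simp add: \<iota>(5))
  have "of_nat m = (0 :: 'f)"
  proof (rule ccontr)
    assume "of_nat m \<noteq> (0 :: 'f)"
    hence "\<iota> (of_nat m) * \<iota> (inverse (of_nat m)) = 1"
      by (simp add: \<iota>(3) flip: \<iota>(2))
    with 0 show False by simp
  qed
  thus "CHAR('f) dvd m" by (simp add: of_nat_eq_0_iff_char_dvd)
qed

section \<open>The evaluation homomorphism\<close>

theorem theorem14:
  fixes k n :: nat
    and star :: "(nat list \<Rightarrow> int poly) \<Rightarrow> (nat list \<Rightarrow> int poly) \<Rightarrow> (nat list \<Rightarrow> int poly)"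
    and \<iota> :: "'f::field \<Rightarrow> 'K::field"
    and \<xi> :: 'K
    and \<zeta> :: "nat \<Rightarrow> 'K"
  assumes "1 \<le> k" and "k < n"
    and "quantum_cup_product k n star"
    and "is_splitting_field \<iota> (Polynomial.monom 1 n + [:(- 1) ^ k:])"
    and "\<xi> ^ n + (- 1) ^ k = 0"
    and "admissible CHAR('f) k n (image_mset \<zeta> (mset_set {1..k}))"
  shows "\<exists>ev \<in> ring_hom (QH k n star :: (nat list \<Rightarrow> (int \<Rightarrow>\<^sub>0 'f)) ring)
                         (ring_of_type_algebra :: 'K ring).
           ev (QH_q k) = 1 \<and>
           (\<forall>i\<in>{1..k}. ev (schubert (column k i)) =
              \<xi> ^ i * (\<Sum>e | e \<in> {1..k} \<rightarrow>\<^sub>E {0, 1::nat} \<and> (\<Sum>j=1..k. e j) = i.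
                         \<Prod>j=1..k. \<zeta> j ^ e j))"
proof -
  have \<iota>: "type_ring_hom \<iota>"
    using assms(4) by (simp add: is_splitting_field_def)
  note eval = type_ring_hom_simps[OF type_ring_hom_laurent_eval[OF this]]
  define z where "z = (\<lambda>l. \<xi> * \<zeta> (Suc l))"
  define v where "v = schubert_value k z"
  have dvd: "(\<Prod>i<k. [:- z i, 1:]) dvd Polynomial.monom 1 n - [:(- 1) ^ (k - 1):]"
    unfolding z_def using assms(6) unfolding CHAR_eq_of_type_ring_hom[OF \<iota>, symmetric]
    by (rule admissible_prod_dvd[OF assms(1,2,5)])
  have v_one: "v (empty_diagram k) = 1"
    unfolding v_def by (rule schubert_value_empty)
  have pieri_v: "esym k j z * v D =
      (\<Sum>D'\<in>pieri_classical k n j D. v D') + (\<Sum>D'\<in>pieri_quantum k n j D. v D')"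
    if "1 \<le> j" "j \<le> k" "D \<in> diagrams k n" for j D
    unfolding v_def
    by (rule schubert_value_pieri[OF assms(1,2) that(2,3)])
      (use divdiff_periodic[OF dvd, of _ 0] in simp)
  have star_v: "specialize k n v (star (schubert D) (schubert E)) = v D * v E"
    if "D \<in> diagrams k n" "E \<in> diagrams k n" for D E
    using specialize_star_schubert[OF assms(3,1,2) v_one pieri_v that(1) schubert_in_free_module[OF that(2)]]
    by (simp add: specialize_schubert that)
  \<comment> \<open>The value is read off from the Pieri rule for the empty diagram, so no
    determinant has to be computed.\<close>
  have v_column: "v (column k i) = esym k i z" if "i \<in> {1..k}" for i
  proof -
    have i: "1 \<le> i" "i \<le> k" using that by auto
    have c: "column k i \<in> diagrams k n" using i assms by (intro column_in_diagrams)
    have "v (column k i) = specialize k n v (star (schubert (column k i)) (schubert (empty_diagram k)))"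
      using star_v[OF c empty_diagram_in_diagrams] v_one by simp
    also have "\<dots> = esym k i z"
      unfolding specialize_pieri[OF assms(3) i empty_diagram_in_diagrams]
      using pieri_v[OF i empty_diagram_in_diagrams] v_one by simp
    finally show ?thesis .
  qed
  define ev where "ev = (\<lambda>a :: nat list \<Rightarrow> (int \<Rightarrow>\<^sub>0 'f). \<Sum>D\<in>diagrams k n. laurent_eval \<iota> (a D) * v D)"
  have ev_scale: "ev (scale c (schubert D)) = laurent_eval \<iota> c * v D" if "D \<in> diagrams k n" for c D
    using that
    by (simp add: ev_def scale_def schubert_def if_distrib[where f = "\<lambda>p. _ * p"] finite_diagrams
        if_distrib[where f = "laurent_eval \<iota>"] if_distrib[where f = "\<lambda>p. p * _"]
        eval cong: if_cong)
  have ev_schubert: "ev (schubert D) = v D" if "D \<in> diagrams k n" for D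
  proof -
    have "scale 1 (schubert D) = (schubert D :: nat list \<Rightarrow> (int \<Rightarrow>\<^sub>0 'f))" by (simp add: scale_def)
    with ev_scale[OF that, of 1] show ?thesis by (simp add: eval)
  qed
  have ev_mult: "ev (\<lambda>G. \<Sum>D\<in>diagrams k n. \<Sum>E\<in>diagrams k n.
      a D * b E * base_change (star (schubert D) (schubert E) G)) = ev a * ev b" for a b
  proof -
    let ?\<epsilon> = "laurent_eval \<iota>" and ?X = "diagrams k n"
    have "ev (\<lambda>G. \<Sum>D\<in>?X. \<Sum>E\<in>?X. a D * b E * base_change (star (schubert D) (schubert E) G)) =
        (\<Sum>G\<in>?X. \<Sum>D\<in>?X. \<Sum>E\<in>?X.
          ?\<epsilon> (a D) * ?\<epsilon> (b E) * (of_int (poly (star (schubert D) (schubert E) G) 1) * v G))"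
      by (simp add: ev_def eval laurent_eval_base_change[OF \<iota>]
          sum_distrib_right mult.assoc)
    \<comment> \<open>Moving the sum over G innermost turns the structure constants into
      \<open>specialize\<close> of a product of two basis elements.\<close>
    also have "\<dots> = (\<Sum>D\<in>?X. \<Sum>G\<in>?X. \<Sum>E\<in>?X.
          ?\<epsilon> (a D) * ?\<epsilon> (b E) * (of_int (poly (star (schubert D) (schubert E) G) 1) * v G))"
      by (rule sum.swap)
    also have "\<dots> = (\<Sum>D\<in>?X. \<Sum>E\<in>?X. \<Sum>G\<in>?X.
          ?\<epsilon> (a D) * ?\<epsilon> (b E) * (of_int (poly (star (schubert D) (schubert E) G) 1) * v G))"
      by (intro sum.cong refl sum.swap)
    also have "\<dots> = (\<Sum>D\<in>?X. \<Sum>E\<in>?X. ?\<epsilon> (a D) * ?\<epsilon> (b E) * (v D * v E))"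
      by (intro sum.cong refl) (simp add: star_v[symmetric] specialize_def sum_distrib_left)
    also have "\<dots> = ev a * ev b"
      by (simp add: ev_def sum_product mult_ac)
    finally show ?thesis .
  qed
  show ?thesis
  proof (intro bexI[of _ ev] conjI ballI)
    show "ev \<in> ring_hom (QH k n star) ring_of_type_algebra"
      using ev_mult ev_schubert[OF empty_diagram_in_diagrams] v_one
      by (auto simp: ring_hom_def QH_def ring_of_type_algebra_def ev_def eval
          distrib_right sum.distrib)
    show "ev (QH_q k) = 1"
      by (simp add: QH_q_def ev_scale empty_diagram_in_diagrams laurent_eval_q[OF \<iota>] v_one)
    fix i assume i: "i \<in> {1..k}"
    hence "column k i \<in> diagrams k n"
      using assms(2) by (intro column_in_diagrams) simp_all
    hence "ev (schubert (column k i)) = esym k i z"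
      using ev_schubert v_column[OF i] by simp
    thus "ev (schubert (column k i)) = \<xi> ^ i *
        (\<Sum>e | e \<in> {1..k} \<rightarrow>\<^sub>E {0, 1::nat} \<and> (\<Sum>j=1..k. e j) = i. \<Prod>j=1..k. \<zeta> j ^ e j)"
      unfolding z_def esym_eq_sum_exponents .
  qed
qed

end
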